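(* Let $H$ be a Hilbert space, $A=A^*$ a selfadjoint operator in $H$, and $\{\varphi_j\}_{j=1}^{\infty}$ an orthonormal basis of $H$ with $A\varphi_j=\lambda_j\varphi_j$, where $(\lambda_j)_{j\ge1}$ is a nondecreasing sequence of positive real numbers diverging to $+\infty$. Let $T>0$, $f\in C^1([0,T];H)$, $u_2\in H$, $g\in C^3([0,T])$, let $\varphi\in\mathcal{D}(A)$ with $\|\varphi\|=1$ and $A\varphi=\lambda_0\varphi$ for some $\lambda_0\in\mathbf{R}\setminus\{0\}$, and assume $$g'(0)=(f(0),\varphi),\qquad g''(0)-(f'(0),\varphi)=0,\qquad g(T)=(u_2,\varphi),\qquad g(0)\neq0 .$$ Let $l\in C^1([0,T];\mathbf{R})$ be non-negative on $[0,T]$ with $l(0)=0$, and, with $L_j$ and $M$ as defined in the context, assume that $$\sum_{j=1}^{\infty}L_j\,\lambda_j^3\,\exp(2\lambda_jMT)<+\infty.$$ Then the problem $$u'(t)=\int_0^t l(t-s)Au(s)\,ds+f(t),\quad 0\le t\le T,\qquad u(T)=u_2,$$ has a solution $u\in C^2([0,T];H)\cap C([0,T];\mathcal{D}(A))$, and this solution is unique.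
   Context: $\mathcal{D}(A)$ carries the graph norm and $(\cdot,\cdot)$, $\|\cdot\|$ are the scalar product and norm of $H$. Write $(a*b)(t)=\int_0^t a(t-s)b(s)\,ds$. Set $\widehat u_{2,j}=(u_2,\varphi_j)$, $\widehat f_j(t)=(f(t),\varphi_j)$, $h=l'$, and $$h^{(1)}(t)=\int_0^t(t-s)l'(s)\,ds=\int_0^t l(s)\,ds .$$ Let $k_j\in C([0,T])$ be the resolvent kernel defined by $(I-\lambda_jV)^{-1}=I+\lambda_jK_j$, where $Vv=h^{(1)}*v$ and $K_jv=k_j*v$; equivalently $k_j=\sum_{m=1}^{\infty}\lambda_j^{m-1}h_m$ with $h_1=h^{(1)}$, $h_m=h^{(1)}*h_{m-1}$. (Since $l\ge0$ and $\lambda_j>0$, $k_j\ge0$, so the denominator below is positive.) Set $$c_j=\frac{\widehat u_{2,j}-\int_0^T\widehat f_j(s)\Big[1+\lambda_j\int_0^{T-s}k_j(\sigma)\,d\sigma\Big]ds}{1+\lambda_j\int_0^Tk_j(s)\,ds},$$ $$L_j=|\widehat u_{2,j}|^2+|c_j|^2+\sup_{0\le t\le T}|\widehat f_j(t)|^2,\qquad M=T\int_0^T|h(t)|\,dt=T\int_0^T|l'(t)|\,dt .$$ *)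

theory Defs
  imports "HOL-Analysis.Analysis"
begin

text \<open>
  Common scalar field of real and complex Hilbert spaces; the instances are \<open>real\<close> and
  \<open>complex\<close>. The last axiom determines the conjugation (and hence its multiplicativity and
  its being the identity on the reals).
\<close>

class rc_scalar = real_normed_field + banach +
  fixes cnj_scalar :: "'a \<Rightarrow> 'a"
  assumes cnj_scalar_add: "cnj_scalar (x + y) = cnj_scalar x + cnj_scalar y"
    and mult_cnj_scalar: "x * cnj_scalar x = (norm x)\<^sup>2 *\<^sub>R 1"

instantiation real :: rc_scalar
begin
definition cnj_scalar_real :: "real \<Rightarrow> real" where "cnj_scalar_real x = x"
instance by standard (auto simp: cnj_scalar_real_def power2_eq_square)
end

instantiation complex :: rc_scalar
begin
definition cnj_scalar_complex :: "complex \<Rightarrow> complex" where "cnj_scalar_complex = cnj"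
instance by standard (simp_all add: cnj_scalar_complex_def scaleR_conv_of_real complex_norm_square [symmetric] del: of_real_power)
end

text \<open>
  A Hilbert space over the scalars \<open>'k\<close>; completeness is part of the class \<open>banach\<close>, whose
  norm is tied to the scalar product by \<open>ip_self\<close>.
\<close>

locale hilbert_space = vector_space smul
  for smul :: "'k::rc_scalar \<Rightarrow> 'a::banach \<Rightarrow> 'a" +
  fixes ip :: "'a \<Rightarrow> 'a \<Rightarrow> 'k"
  assumes scale_of_real: "smul (of_real r) x = r *\<^sub>R x"
    and ip_add_left: "ip (x + y) z = ip x z + ip y z"
    and ip_scale_left: "ip (smul c x) y = c * ip x y"
    and ip_commute: "ip y x = cnj_scalar (ip x y)"
    and ip_self: "ip x x = of_real ((norm x)\<^sup>2)"

lemma hilbert_space_real_inner: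
  "hilbert_space (scaleR :: real \<Rightarrow> 'a \<Rightarrow> 'a) (inner :: 'a::{real_inner,banach} \<Rightarrow> 'a \<Rightarrow> real)"
  by unfold_locales
    (auto simp: algebra_simps inner_commute cnj_scalar_real_def power2_norm_eq_inner)

lemma hilbert_space_complex:
  "hilbert_space ((*) :: complex \<Rightarrow> complex \<Rightarrow> complex) (\<lambda>x y. x * cnj y)"
  by unfold_locales
    (simp_all add: algebra_simps cnj_scalar_complex_def scaleR_conv_of_real complex_norm_square [symmetric] del: of_real_power)

definition orthonormal_basis ::
  "('k::rc_scalar \<Rightarrow> 'a::banach \<Rightarrow> 'a) \<Rightarrow> ('a \<Rightarrow> 'a \<Rightarrow> 'k) \<Rightarrow> (nat \<Rightarrow> 'a) \<Rightarrow> bool" where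
  "orthonormal_basis smul ip \<phi> \<longleftrightarrow>
     (\<forall>i j. ip (\<phi> i) (\<phi> j) = (if i = j then 1 else 0)) \<and>
     closure (module.span smul (range \<phi>)) = UNIV"

text \<open>
  An unbounded operator is a domain \<open>D\<close> together with a function \<open>A\<close> whose values off \<open>D\<close> are
  irrelevant.
\<close>

definition adjoint_graph ::
  "('a \<Rightarrow> 'a \<Rightarrow> 'k) \<Rightarrow> 'a set \<Rightarrow> ('a \<Rightarrow> 'a) \<Rightarrow> ('a \<times> 'a) set" where
  "adjoint_graph ip D A = {(y, z). \<forall>x\<in>D. ip (A x) y = ip x z}"

definition selfadjoint_operator ::
  "('k::rc_scalar \<Rightarrow> 'a::banach \<Rightarrow> 'a) \<Rightarrow> ('a \<Rightarrow> 'a \<Rightarrow> 'k) \<Rightarrow> 'a set \<Rightarrow> ('a \<Rightarrow> 'a) \<Rightarrow> bool" where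
  "selfadjoint_operator smul ip D A \<longleftrightarrow>
     module.subspace smul D \<and> closure D = UNIV \<and>
     (\<forall>x\<in>D. \<forall>y\<in>D. A (x + y) = A x + A y) \<and>
     (\<forall>c. \<forall>x\<in>D. A (smul c x) = smul c (A x)) \<and>
     adjoint_graph ip D A = {(x, A x) | x. x \<in> D}"

definition graph_norm :: "('a::real_normed_vector \<Rightarrow> 'a) \<Rightarrow> 'a \<Rightarrow> real" where
  "graph_norm A x = norm x + norm (A x)"

definition continuous_on_into_domain ::
  "'a set \<Rightarrow> ('a::real_normed_vector \<Rightarrow> 'a) \<Rightarrow> real set \<Rightarrow> (real \<Rightarrow> 'a) \<Rightarrow> bool" where
  "continuous_on_into_domain D A S u \<longleftrightarrow>
     (\<forall>t\<in>S. u t \<in> D) \<and>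
     (\<forall>t\<in>S. ((\<lambda>s. graph_norm A (u s - u t)) \<longlongrightarrow> 0) (at t within S))"

definition deriv_on :: "real set \<Rightarrow> (real \<Rightarrow> 'a::real_normed_vector) \<Rightarrow> real \<Rightarrow> 'a" where
  "deriv_on S f t = vector_derivative f (at t within S)"

text \<open>The class \<open>C\<^sup>k\<close> on \<open>S\<close>, with one-sided derivatives at the end points of an interval.\<close>

primrec Ck_on :: "nat \<Rightarrow> real set \<Rightarrow> (real \<Rightarrow> 'a::real_normed_vector) \<Rightarrow> bool" where
  "Ck_on 0 S f \<longleftrightarrow> continuous_on S f"
| "Ck_on (Suc k) S f \<longleftrightarrow>
     (\<forall>t\<in>S. f differentiable (at t within S)) \<and> Ck_on k S (deriv_on S f)"

definition conv :: "(real \<Rightarrow> real) \<Rightarrow> (real \<Rightarrow> real) \<Rightarrow> real \<Rightarrow> real" where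
  "conv a b t = integral {0..t} (\<lambda>s. a (t - s) * b s)"

definition h1 :: "(real \<Rightarrow> real) \<Rightarrow> real \<Rightarrow> real" where
  "h1 l t = integral {0..t} l"

text \<open>\<open>iterated_kernel l m\<close> is the \<open>(m + 1)\<close>-fold convolution power of \<open>h1 l\<close>.\<close>

primrec iterated_kernel :: "(real \<Rightarrow> real) \<Rightarrow> nat \<Rightarrow> real \<Rightarrow> real" where
  "iterated_kernel l 0 = h1 l"
| "iterated_kernel l (Suc m) = conv (h1 l) (iterated_kernel l m)"

text \<open>
  The kernel \<open>k\<close> with \<open>(I - \<mu> V)\<^sup>-\<^sup>1 = I + \<mu> K\<close>, where \<open>V v = conv (h1 l) v\<close> and
  \<open>K v = conv k v\<close>, given by its Neumann series.
\<close>

definition resolvent_kernel :: "(real \<Rightarrow> real) \<Rightarrow> real \<Rightarrow> real \<Rightarrow> real" where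
  "resolvent_kernel l \<mu> t = (\<Sum>m. \<mu> ^ m * iterated_kernel l m t)"

text \<open>
  In \<open>c_coeff\<close> and \<open>L_coeff\<close>, \<open>a\<close> stands for the coefficient \<open>(u\<^sub>2, \<phi>\<^sub>j)\<close>, \<open>b\<close> for the function
  \<open>t \<mapsto> (f(t), \<phi>\<^sub>j)\<close> and \<open>\<mu>\<close> for the eigenvalue \<open>\<lambda>\<^sub>j\<close>.
\<close>

definition c_coeff ::
  "real \<Rightarrow> (real \<Rightarrow> real) \<Rightarrow> real \<Rightarrow> 'k::rc_scalar \<Rightarrow> (real \<Rightarrow> 'k) \<Rightarrow> 'k" where
  "c_coeff T l \<mu> a b =
     (a - integral {0..T}
            (\<lambda>s. b s * of_real (1 + \<mu> * integral {0..T - s} (resolvent_kernel l \<mu>))))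
     / of_real (1 + \<mu> * integral {0..T} (resolvent_kernel l \<mu>))"

definition L_coeff ::
  "real \<Rightarrow> (real \<Rightarrow> real) \<Rightarrow> real \<Rightarrow> 'k::rc_scalar \<Rightarrow> (real \<Rightarrow> 'k) \<Rightarrow> real" where
  "L_coeff T l \<mu> a b =
     (norm a)\<^sup>2 + (norm (c_coeff T l \<mu> a b))\<^sup>2 + (SUP t\<in>{0..T}. (norm (b t))\<^sup>2)"

definition M_const :: "real \<Rightarrow> (real \<Rightarrow> real) \<Rightarrow> real" where
  "M_const T l = T * integral {0..T} (\<lambda>t. \<bar>deriv_on {0..T} l t\<bar>)"

definition is_solution ::
  "'a::banach set \<Rightarrow> ('a \<Rightarrow> 'a) \<Rightarrow> real \<Rightarrow> (real \<Rightarrow> real) \<Rightarrow> (real \<Rightarrow> 'a) \<Rightarrow> 'a \<Rightarrow> (real \<Rightarrow> 'a) \<Rightarrow> bool" where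
  "is_solution D A T l f u2 u \<longleftrightarrow>
     Ck_on 2 {0..T} u \<and>
     continuous_on_into_domain D A {0..T} u \<and>
     (\<forall>t\<in>{0..T}. deriv_on {0..T} u t =
        integral {0..t} (\<lambda>s. l (t - s) *\<^sub>R A (u s)) + f t) \<and>
     u T = u2"

end

theory Submission
  imports Defs
begin

text \<open>
  Pairing a solution with \<open>\<phi>\<^sub>j\<close> and integrating once turns the problem into the scalar Volterra
  equations \<open>y = c + 1 * b\<^sub>j + \<lambda>\<^sub>j (h\<^sub>1 * y)\<close>, where \<open>*\<close> is convolution, \<open>h\<^sub>1 = 1 * l\<close> and
  \<open>b\<^sub>j(t) = (f(t), \<phi>\<^sub>j)\<close>. With \<open>E\<^sub>j = 1 + \<lambda>\<^sub>j (1 * k\<^sub>j)\<close>, associativity of convolution and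
  \<open>k\<^sub>j = h\<^sub>1 + \<lambda>\<^sub>j (h\<^sub>1 * k\<^sub>j)\<close> show that the unique solution is \<open>y\<^sub>j = c E\<^sub>j + E\<^sub>j * b\<^sub>j\<close>. Since
  \<open>E\<^sub>j(T) \<ge> 1\<close>, the terminal condition determines \<open>c = c\<^sub>j\<close>, which gives uniqueness.
  For existence, \<open>h\<^sub>1 \<le> M\<close> gives \<open>E\<^sub>j \<le> exp (\<lambda>\<^sub>j M T)\<close>, so by the summability hypothesis the series
  \<open>\<Sum>\<^sub>j y\<^sub>j \<phi>\<^sub>j\<close> and \<open>\<Sum>\<^sub>j \<lambda>\<^sub>j y\<^sub>j \<phi>\<^sub>j\<close> converge uniformly, to \<open>u\<close> and, \<open>A\<close> being closed, to \<open>A u\<close>.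
  Comparing coefficients, \<open>u' = l * A u + f\<close>; as \<open>l(0) = 0\<close>, \<open>l * A u = 1 * (l' * A u)\<close> is \<open>C\<^sup>1\<close>.
\<close>

subsection \<open>Convolution\<close>

text \<open>Moves an interval with variable ends to the fixed interval [0, 1]. The equivalence
  \<open>iff\<close> carries non-integrability over as well, and then both integrals are 0, so the
  identity holds for every \<open>g\<close>.\<close>

lemma integral_rescale:
  fixes g :: "real \<Rightarrow> 'b::banach"
  assumes "a \<le> b"
  shows "integral {a..b} g = (b - a) *\<^sub>R integral {0..1} (\<lambda>x. g (a + x * (b - a)))"
proof (cases "a = b")
  case False
  then have ab: "b - a > 0" using assms by simp
  have iff: "((\<lambda>x. g (a + x * (b - a))) has_integral (I /\<^sub>R (b - a))) {0..1} \<longleftrightarrow> (g has_integral I) {a..b}" for I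
    using has_integral_affinity_iff [OF ab, of g a I a b] ab
    by (simp add: add.commute mult.commute)
  show ?thesis
  proof (cases "g integrable_on {a..b}")
    case True
    then have "(g has_integral integral {a..b} g) {a..b}" by blast
    then have "integral {0..1} (\<lambda>x. g (a + x * (b - a))) = integral {a..b} g /\<^sub>R (b - a)"
      using iff by blast
    then show ?thesis using ab by simp
  next
    case False
    then have "\<not> (\<lambda>x. g (a + x * (b - a))) integrable_on {0..1}"
      using iff [of "(b - a) *\<^sub>R _"] ab by (auto simp: integrable_on_def)
    with False show ?thesis by (simp add: not_integrable_integral)
  qed
qed simp

text \<open>After rescaling to [0, 1] the domain of integration does not depend on \<open>x\<close>,
  so continuity of a parameter integral over a fixed compact interval applies.\<close>

lemma continuous_on_integral_variable_bounds:
  fixes G :: "real \<Rightarrow> real \<Rightarrow> 'b::banach"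
  assumes a: "continuous_on S a" and b: "continuous_on S b"
    and le: "\<And>x. x \<in> S \<Longrightarrow> a x \<le> b x"
    and G: "continuous_on {(x, y). x \<in> S \<and> y \<in> {a x..b x}} (\<lambda>(x, y). G x y)"
  shows "continuous_on S (\<lambda>x. integral {a x..b x} (G x))"
proof -
  let ?p = "\<lambda>(x, y). (x, a x + y * (b x - a x))"
  have "continuous_on (S \<times> cbox 0 1) (\<lambda>z. (\<lambda>(x, y). G x y) (?p z))"
  proof (rule continuous_on_compose2 [OF G])
    show "continuous_on (S \<times> cbox 0 1) ?p"
      unfolding case_prod_beta
      by (intro continuous_intros continuous_on_compose2 [OF a] continuous_on_compose2 [OF b]) auto
    have "a x + y * (b x - a x) \<le> b x" if "x \<in> S" "y \<le> 1" for x y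
      using mult_right_mono [OF that(2), of "b x - a x"] le [OF that(1)] by simp
    then show "?p ` (S \<times> cbox 0 1) \<subseteq> {(x, y). x \<in> S \<and> y \<in> {a x..b x}}"
      using le by auto
  qed
  then have "continuous_on S (\<lambda>x. integral (cbox 0 1) (\<lambda>y. G x (a x + y * (b x - a x))))"
    by (intro integral_continuous_on_param) (simp add: case_prod_beta)
  then have "continuous_on S (\<lambda>x. (b x - a x) *\<^sub>R integral {0..1} (\<lambda>y. G x (a x + y * (b x - a x))))"
    using a b by (auto intro!: continuous_intros)
  then show ?thesis
    by (rule continuous_on_eq) (use le in \<open>auto simp: integral_rescale [OF le]\<close>)
qed

text \<open>The difference quotients are bounded by \<open>C * \<bar>t - s\<bar>\<close> and so tend
  to 0: the derivative vanishes on the whole interval.\<close>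

lemma quadratic_increments_imp_constant:
  fixes \<Theta> :: "real \<Rightarrow> 'b::real_normed_vector"
  assumes "\<And>s t. a \<le> s \<Longrightarrow> s \<le> t \<Longrightarrow> t \<le> b \<Longrightarrow> norm (\<Theta> t - \<Theta> s) \<le> C * (t - s)\<^sup>2"
    and t: "t \<in> {a..b}"
  shows "\<Theta> t = \<Theta> a"
proof (rule has_derivative_zero_unique [of "{a..b}"])
  fix x assume x: "x \<in> {a..b}"
  have bd: "norm (\<Theta> y - \<Theta> x) \<le> C * (y - x)\<^sup>2" if "y \<in> {a..b}" for y
    using assms(1) [of x y] assms(1) [of y x] x that
    by (cases "x \<le> y") (auto simp: norm_minus_commute power2_commute)
  have "((\<lambda>y. (1 / norm (y - x)) *\<^sub>R (\<Theta> y - (\<Theta> x + 0))) \<longlongrightarrow> 0) (at x within {a..b})"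
  proof (rule Lim_null_comparison)
    show "\<forall>\<^sub>F y in at x within {a..b}. norm ((1 / norm (y - x)) *\<^sub>R (\<Theta> y - (\<Theta> x + 0))) \<le> C * \<bar>y - x\<bar>"
    proof (unfold eventually_at_filter, intro always_eventually allI impI)
      fix y assume "y \<noteq> x" "y \<in> {a..b}"
      then show "norm ((1 / norm (y - x)) *\<^sub>R (\<Theta> y - (\<Theta> x + 0))) \<le> C * \<bar>y - x\<bar>"
        using bd [of y] by (simp add: divide_simps power2_eq_square abs_mult_self_eq flip: mult.assoc)
    qed
    show "((\<lambda>y. C * \<bar>y - x\<bar>) \<longlongrightarrow> 0) (at x within {a..b})"
      by (auto intro!: tendsto_eq_intros)
  qed
  then show "(\<Theta> has_derivative (\<lambda>h. 0)) (at x within {a..b})"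
    by (simp add: has_derivative_within)
qed (use t in auto)

text \<open>
  The increments over \<open>[s, t]\<close> of the two sides agree up to integrals over triangles of area
  \<open>(t - s)\<^sup>2 / 2\<close>, by Fubini on the rectangle \<open>[s, t] \<times> [0, s]\<close>. This also covers values in
  non-separable Banach spaces, where the Bochner version of Fubini's theorem is not available.
\<close>

lemma integral_triangle_swap:
  fixes G :: "real \<Rightarrow> real \<Rightarrow> 'b::banach"
  assumes G: "continuous_on {(s, r). 0 \<le> r \<and> r \<le> s \<and> s \<le> T} (\<lambda>(s, r). G s r)"
    and t: "t \<in> {0..T}"
  shows "integral {0..t} (\<lambda>s. integral {0..s} (G s)) =
         integral {0..t} (\<lambda>r. integral {r..t} (\<lambda>s. G s r))"
proof -
  let ?\<Delta> = "{(s, r). 0 \<le> r \<and> r \<le> s \<and> s \<le> T}"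
  define L where "L t = integral {0..t} (\<lambda>s. integral {0..s} (G s))" for t
  define R where "R t = integral {0..t} (\<lambda>r. integral {r..t} (\<lambda>s. G s r))" for t
  have cp: "compact ?\<Delta>"
  proof -
    have "?\<Delta> = ({0..T} \<times> {0..T}) \<inter> {z. snd z \<le> fst z}" by auto
    moreover have "closed {z::real \<times> real. snd z \<le> fst z}"
      by (intro closed_Collect_le continuous_intros)
    ultimately show ?thesis by (simp add: compact_Int_closed compact_Times)
  qed
  have "bounded ((\<lambda>(s, r). G s r) ` ?\<Delta>)"
    by (intro compact_imp_bounded compact_continuous_image G cp)
  then obtain C where C: "\<And>s r. 0 \<le> r \<Longrightarrow> r \<le> s \<Longrightarrow> s \<le> T \<Longrightarrow> norm (G s r) \<le> C"
    unfolding bounded_iff by (auto simp: image_iff)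
  have cs: "continuous_on {p..q} (\<lambda>x. integral {a x..b x} (G x))"
    if "continuous_on {p..q} a" "continuous_on {p..q} b" "q \<le> T"
      "\<And>x. x \<in> {p..q} \<Longrightarrow> 0 \<le> a x \<and> a x \<le> b x \<and> b x \<le> x" for p q a b
  proof (rule continuous_on_integral_variable_bounds)
    show "continuous_on {(x, y). x \<in> {p..q} \<and> y \<in> {a x..b x}} (\<lambda>(x, y). G x y)"
      using that(3,4) by (force intro: continuous_on_subset [OF G])
  qed (use that in auto)
  have cr: "continuous_on {p..q} (\<lambda>x. integral {a x..b x} (\<lambda>s. G s x))"
    if "continuous_on {p..q} a" "continuous_on {p..q} b" "0 \<le> p"
      "\<And>x. x \<in> {p..q} \<Longrightarrow> x \<le> a x \<and> a x \<le> b x \<and> b x \<le> T" for p q a b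
  proof (rule continuous_on_integral_variable_bounds)
    have "continuous_on {(x, y). x \<in> {p..q} \<and> y \<in> {a x..b x}} (\<lambda>z. (\<lambda>(s, r). G s r) (snd z, fst z))"
      by (rule continuous_on_compose2 [OF G])
        (use that(3,4) in \<open>force intro!: continuous_intros simp: image_subset_iff\<close>)+
    then show "continuous_on {(x, y). x \<in> {p..q} \<and> y \<in> {a x..b x}} (\<lambda>(x, y). G y x)"
      by (simp add: case_prod_beta)
  qed (use that in auto)
  have gs: "continuous_on {a..b} (G x)" if "0 \<le> a" "b \<le> x" "x \<le> T" for a b x
  proof -
    have "continuous_on {a..b} (\<lambda>y. (\<lambda>(s, r). G s r) (x, y))"
      by (rule continuous_on_compose2 [OF G]) (use that in \<open>force intro!: continuous_intros\<close>)+
    then show ?thesis by simp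
  qed
  have gr: "continuous_on {a..b} (\<lambda>s. G s x)" if "0 \<le> x" "x \<le> a" "b \<le> T" for a b x
  proof -
    have "continuous_on {a..b} (\<lambda>y. (\<lambda>(s, r). G s r) (y, x))"
      by (rule continuous_on_compose2 [OF G]) (use that in \<open>force intro!: continuous_intros\<close>)+
    then show ?thesis by simp
  qed
  \<comment> \<open>Each triangle contributes at most \<open>C * (t - s)\<^sup>2\<close>, without
    use of the factor 1/2 in its area; the two triangles together give \<open>2 * C\<close>.\<close>
  have "norm ((L t - R t) - (L s - R s)) \<le> (2 * C) * (t - s)\<^sup>2" if st: "0 \<le> s" "s \<le> t" "t \<le> T" for s t
  proof -
    have C0: "0 \<le> C" using C [of 0 0] st by (metis norm_ge_zero order_trans order_refl)
    have "L t - L s = integral {s..t} (\<lambda>x. integral {0..x} (G x))"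
    proof -
      have "(\<lambda>x. integral {0..x} (G x)) integrable_on {0..t}"
        by (intro integrable_continuous_real cs) (use st in \<open>auto intro!: continuous_intros\<close>)
      then show ?thesis
        using Henstock_Kurzweil_Integration.integral_combine [of 0 s t "\<lambda>x. integral {0..x} (G x)"] st
        by (simp add: L_def algebra_simps)
    qed
    also have "\<dots> = integral {s..t} (\<lambda>x. integral {0..s} (G x) + integral {s..x} (G x))"
      by (intro integral_cong Henstock_Kurzweil_Integration.integral_combine [symmetric] integrable_continuous_real gs) (use st in auto)
    also have "\<dots> = integral {s..t} (\<lambda>x. integral {0..s} (G x)) + integral {s..t} (\<lambda>x. integral {s..x} (G x))"
      by (intro integral_add integrable_continuous_real cs) (use st in \<open>auto intro!: continuous_intros\<close>)
    finally have Leq: "L t - L s = \<dots>" .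
    have "R t = integral {0..s} (\<lambda>r. integral {r..t} (\<lambda>x. G x r)) + integral {s..t} (\<lambda>r. integral {r..t} (\<lambda>x. G x r))"
      unfolding R_def
      by (intro Henstock_Kurzweil_Integration.integral_combine [symmetric] integrable_continuous_real cr) (use st in \<open>auto intro!: continuous_intros\<close>)
    also have "integral {0..s} (\<lambda>r. integral {r..t} (\<lambda>x. G x r)) =
        integral {0..s} (\<lambda>r. integral {r..s} (\<lambda>x. G x r) + integral {s..t} (\<lambda>x. G x r))"
      by (intro integral_cong Henstock_Kurzweil_Integration.integral_combine [symmetric] integrable_continuous_real gr) (use st in auto)
    also have "\<dots> = R s + integral {0..s} (\<lambda>r. integral {s..t} (\<lambda>x. G x r))"
      unfolding R_def
      by (intro integral_add integrable_continuous_real cr) (use st in \<open>auto intro!: continuous_intros\<close>)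
    also have "integral {0..s} (\<lambda>r. integral {s..t} (\<lambda>x. G x r)) = integral {s..t} (\<lambda>x. integral {0..s} (G x))"
    proof -
      have "cbox (s, 0) (t, s) \<subseteq> ?\<Delta>" using st by (auto simp: cbox_Pair_eq)
      then show ?thesis
        using integral_swap_continuous [of s 0 t s G] continuous_on_subset [OF G] by simp
    qed
    finally have Req: "R t - R s = integral {s..t} (\<lambda>x. integral {0..s} (G x)) + integral {s..t} (\<lambda>r. integral {r..t} (\<lambda>x. G x r))"
      by simp
    have "norm (integral {s..t} (\<lambda>x. integral {s..x} (G x))) \<le> (C * (t - s)) * (t - s)"
    proof (intro integral_bound cs)
      fix x assume x: "x \<in> {s..t}"
      have "norm (integral {s..x} (G x)) \<le> C * (x - s)"
        by (intro integral_bound gs C) (use x st in auto)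
      also have "\<dots> \<le> C * (t - s)" using x C0 by (intro mult_left_mono) auto
      finally show "norm (integral {s..x} (G x)) \<le> C * (t - s)" .
    qed (use st in \<open>auto intro!: continuous_intros\<close>)
    moreover have "norm (integral {s..t} (\<lambda>r. integral {r..t} (\<lambda>x. G x r))) \<le> (C * (t - s)) * (t - s)"
    proof (intro integral_bound cr)
      fix r assume r: "r \<in> {s..t}"
      have "norm (integral {r..t} (\<lambda>x. G x r)) \<le> C * (t - r)"
        by (intro integral_bound gr C) (use r st in auto)
      also have "\<dots> \<le> C * (t - s)" using r C0 by (intro mult_left_mono) auto
      finally show "norm (integral {r..t} (\<lambda>x. G x r)) \<le> C * (t - s)" .
    qed (use st in \<open>auto intro!: continuous_intros\<close>)
    moreover have "(L t - R t) - (L s - R s) =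
        integral {s..t} (\<lambda>x. integral {s..x} (G x)) - integral {s..t} (\<lambda>r. integral {r..t} (\<lambda>x. G x r))"
      using Leq Req by (simp add: algebra_simps)
    ultimately have "norm ((L t - R t) - (L s - R s)) \<le> C * (t - s) * (t - s) + C * (t - s) * (t - s)"
      by (smt (verit) norm_triangle_ineq4)
    then show ?thesis by (simp add: power2_eq_square)
  qed
  then have "L t - R t = L 0 - R 0"
    using t by (intro quadratic_increments_imp_constant [of 0 T _ "2 * C"]) auto
  then show ?thesis by (simp add: L_def R_def)
qed

text \<open>The kernel is real and the other factor has values in any Banach space, so that the same
  rules serve for kernels, for coefficients in \<open>'k\<close> and for functions with values in
  the Hilbert space.\<close>

definition vconv :: "(real \<Rightarrow> real) \<Rightarrow> (real \<Rightarrow> 'b::banach) \<Rightarrow> real \<Rightarrow> 'b" where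
  "vconv a w t = integral {0..t} (\<lambda>s. a (t - s) *\<^sub>R w s)"

lemma conv_eq_vconv: "conv a b = vconv a b"
  by (simp add: conv_def vconv_def fun_eq_iff)

lemma vconv_cong:
  assumes "\<And>s. s \<in> {0..t} \<Longrightarrow> a s = a' s" "\<And>s. s \<in> {0..t} \<Longrightarrow> w s = w' s"
  shows "vconv a w t = vconv a' w' t"
  unfolding vconv_def by (rule integral_cong) (simp add: assms)

lemma vconv_0 [simp]: "vconv a w 0 = 0"
  by (simp add: vconv_def)

lemma vconv_1: "vconv (\<lambda>_. 1) w t = integral {0..t} w"
  by (simp add: vconv_def)

section \<open>Rules and bounds for convolution on [0, T]\<close>

context
  fixes T :: real
begin

lemma continuous_on_vconv_integrand:
  fixes w :: "real \<Rightarrow> 'b::banach"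
  assumes "continuous_on {0..T} a" "continuous_on {0..T} w" "t \<in> {0..T}"
  shows "continuous_on {0..t} (\<lambda>s. a (t - s) *\<^sub>R w s)"
proof (intro continuous_on_scaleR)
  show "continuous_on {0..t} (\<lambda>s. a (t - s))"
    by (rule continuous_on_compose2 [OF assms(1)]) (use assms(3) in \<open>auto intro!: continuous_intros\<close>)
qed (use assms(3) in \<open>auto intro: continuous_on_subset [OF assms(2)]\<close>)

lemmas integrable_vconv = integrable_continuous_real [OF continuous_on_vconv_integrand]

lemma continuous_on_vconv:
  assumes a: "continuous_on {0..T} a" and w: "continuous_on {0..T} w"
  shows "continuous_on {0..T} (vconv a w)"
  unfolding vconv_def
  by (rule continuous_on_integral_variable_bounds)
    (auto simp: case_prod_beta intro!: continuous_intros
      intro: continuous_on_compose2 [OF a] continuous_on_compose2 [OF w])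

lemma vconv_add_right:
  assumes "continuous_on {0..T} a" "continuous_on {0..T} w" "continuous_on {0..T} v" "t \<in> {0..T}"
  shows "vconv a (\<lambda>s. w s + v s) t = vconv a w t + vconv a v t"
  unfolding vconv_def scaleR_add_right using assms by (intro integral_add integrable_vconv)

lemma vconv_add_left:
  assumes "continuous_on {0..T} a" "continuous_on {0..T} b" "continuous_on {0..T} w" "t \<in> {0..T}"
  shows "vconv (\<lambda>s. a s + b s) w t = vconv a w t + vconv b w t"
  unfolding vconv_def scaleR_add_left using assms by (intro integral_add integrable_vconv)

text \<open>A bounded linear map passes under the integral and commutes with the real factor. It
  serves to pass to coefficients \<open>ip x p\<close>, to pull out scalars, and to go from real
  functions to multiples of a fixed vector.\<close>

lemma vconv_linear:
  assumes "bounded_linear h" "continuous_on {0..T} a" "continuous_on {0..T} w" "t \<in> {0..T}"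
  shows "vconv a (\<lambda>s. h (w s)) t = h (vconv a w t)"
proof -
  interpret h: bounded_linear h by fact
  show ?thesis
    using integral_linear [OF integrable_vconv [OF assms(2-4)] assms(1)]
    by (simp add: vconv_def o_def h.scaleR)
qed

lemma vconv_scale_left: "vconv (\<lambda>s. c * a s) w t = c *\<^sub>R vconv a w t"
  unfolding vconv_def by (simp flip: scaleR_scaleR integral_cmul)

text \<open>The substitution of \<open>t - s\<close> for \<open>s\<close>, carried out as a
  reflection at 0 and a shift by \<open>t\<close>.\<close>

lemma vconv_commute:
  fixes a b :: "real \<Rightarrow> real"
  shows "vconv a b t = vconv b a t"
proof -
  have "integral {- t..- 0} (\<lambda>s. a (t - - s) *\<^sub>R b (- s)) = vconv a b t"
    unfolding vconv_def by (rule Henstock_Kurzweil_Integration.integral_reflect_real)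
  moreover have "integral {0 - t..t - t} (\<lambda>s. (\<lambda>x. b (t - x) *\<^sub>R a x) (s + t)) = vconv b a t"
    unfolding vconv_def by (rule integral_shift_real_ivl)
  ultimately show ?thesis by (simp add: algebra_simps)
qed

text \<open>Swapping the order of integration over the triangle
  \<open>0 \<le> r \<le> s \<le> t\<close> leaves, for fixed \<open>r\<close>, an inner integral
  that becomes \<open>vconv a b (t - r)\<close> after a shift by \<open>r\<close>.\<close>

lemma vconv_assoc:
  assumes a: "continuous_on {0..T} a" and b: "continuous_on {0..T} b" and w: "continuous_on {0..T} w"
    and t: "t \<in> {0..T}"
  shows "vconv (vconv a b) w t = vconv a (vconv b w) t"
proof -
  have "vconv a (vconv b w) t = integral {0..t} (\<lambda>s. integral {0..s} (\<lambda>r. a (t - s) *\<^sub>R b (s - r) *\<^sub>R w r))"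
    by (simp only: vconv_def integral_cmul)
  also have "\<dots> = integral {0..t} (\<lambda>r. integral {r..t} (\<lambda>s. a (t - s) *\<^sub>R b (s - r) *\<^sub>R w r))"
    by (rule integral_triangle_swap [of t])
      (use t in \<open>auto simp: case_prod_beta intro!: continuous_intros
        intro: continuous_on_compose2 [OF a] continuous_on_compose2 [OF b] continuous_on_compose2 [OF w]\<close>)
  also have "\<dots> = integral {0..t} (\<lambda>r. vconv a b (t - r) *\<^sub>R w r)"
  proof (rule integral_cong)
    fix r assume r: "r \<in> {0..t}"
    have "integral {r..t} (\<lambda>s. a (t - s) *\<^sub>R b (s - r) *\<^sub>R w r)
      = integral {r..t} (\<lambda>s. a (t - s) * b (s - r)) *\<^sub>R w r"
      using integral_linear [OF _ bounded_linear_scaleR_left, of "\<lambda>s. a (t - s) * b (s - r)" "{r..t}" "w r"]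
        integrable_continuous_real [of r t "\<lambda>s. a (t - s) * b (s - r)"] t r
      by (force simp: o_def intro!: continuous_intros continuous_on_compose2 [OF a] continuous_on_compose2 [OF b])
    also have "integral {r..t} (\<lambda>s. a (t - s) * b (s - r)) = vconv a b (t - r)"
      using integral_shift_real_ivl [of r r t "\<lambda>s. a (t - s) * b (s - r)"]
      by (simp add: vconv_def algebra_simps)
    finally show "integral {r..t} (\<lambda>s. a (t - s) *\<^sub>R b (s - r) *\<^sub>R w r) = vconv a b (t - r) *\<^sub>R w r" .
  qed
  finally show ?thesis by (simp add: vconv_def)
qed

lemma norm_vconv_le:
  assumes a: "continuous_on {0..T} a" and w: "continuous_on {0..T} w"
    and A: "\<And>s. s \<in> {0..t} \<Longrightarrow> \<bar>a s\<bar> \<le> A" and W: "\<And>s. s \<in> {0..t} \<Longrightarrow> norm (w s) \<le> W"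
    and t: "t \<in> {0..T}"
  shows "norm (vconv a w t) \<le> A * W * t"
proof -
  have "0 \<le> A" using A [of 0] t by fastforce
  then have "norm (vconv a w t) \<le> A * W * (t - 0)"
    unfolding vconv_def using t A W
    by (intro integral_bound continuous_on_vconv_integrand a w) (auto intro!: mult_mono)
  then show ?thesis by simp
qed

end

text \<open>Uniform convergence survives multiplication by the bounded factor
  \<open>a (t - s)\<close> and permits the exchange of limit and integral. This is the passage to
  the limit in the Neumann series.\<close>

lemma tendsto_vconv:
  assumes a: "continuous_on {0..T} a" and w: "\<And>n. continuous_on {0..T} (w n)"
    and lim: "uniform_limit {0..T} w v sequentially" and t: "t \<in> {0..T}"
  shows "(\<lambda>n. vconv a (w n) t) \<longlonglongrightarrow> vconv a v t"
proof -
  have sub: "{0..t} \<subseteq> {0..T}" using t by auto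
  have a': "continuous_on {0..t} (\<lambda>s. a (t - s))"
    by (rule continuous_on_compose2 [OF a]) (use t in \<open>auto intro!: continuous_intros\<close>)
  have v: "continuous_on {0..T} v"
    by (rule uniform_limit_theorem [OF _ lim]) (auto simp: w)
  have "uniform_limit {0..t} (\<lambda>n s. a (t - s) *\<^sub>R w n s) (\<lambda>s. a (t - s) *\<^sub>R v s) sequentially"
  proof (rule bounded_bilinear.bounded_uniform_limit [OF bounded_bilinear_scaleR])
    show "bounded ((\<lambda>s. a (t - s)) ` {0..t})" "bounded (v ` {0..t})"
      by (auto intro!: compact_imp_bounded compact_continuous_image a' continuous_on_subset [OF v sub])
  qed (auto intro: uniform_limit_on_subset [OF lim sub] uniform_limit_const)
  then obtain I J where IJ: "\<And>n. ((\<lambda>s. a (t - s) *\<^sub>R w n s) has_integral I n) {0..t}"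
    "((\<lambda>s. a (t - s) *\<^sub>R v s) has_integral J) {0..t}" "I \<longlonglongrightarrow> J"
    by (rule uniform_limit_integral)
      (auto intro!: continuous_on_scaleR a' continuous_on_subset [OF w sub])
  then show ?thesis
    unfolding vconv_def by (simp add: IJ(1,2) [THEN integral_unique])
qed

text \<open>The scalar identity \<open>a * 1 = 1 * a\<close>, transported by the linear map
  \<open>\<lambda>r. r *\<^sub>R c\<close>.\<close>

lemma vconv_const:
  assumes "continuous_on {0..T} a" "t \<in> {0..T}"
  shows "vconv a (\<lambda>_. c) t = integral {0..t} a *\<^sub>R c"
  using vconv_linear [OF bounded_linear_scaleR_left, of T a "\<lambda>_. 1" t c] assms
  by (simp add: vconv_commute [of a] vconv_1)

subsection \<open>The classes \<open>C\<^sup>k\<close>\<close>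

lemma Ck_on_imp_continuous_on: "Ck_on k S f \<Longrightarrow> continuous_on S f"
  by (cases k) (auto intro: differentiable_imp_continuous_on simp: differentiable_on_def)

lemma has_vector_derivative_deriv_on:
  assumes "Ck_on (Suc k) S f" "t \<in> S"
  shows "(f has_vector_derivative deriv_on S f t) (at t within S)"
  using assms by (auto simp: deriv_on_def vector_derivative_works)

lemma Ck_on_Suc_imp_integral_deriv_on:
  fixes f :: "real \<Rightarrow> 'b::banach"
  assumes "Ck_on (Suc k) {a..b} f" "t \<in> {a..b}"
  shows "f t = f a + integral {a..t} (deriv_on {a..b} f)"
proof -
  have "(deriv_on {a..b} f has_integral (f t - f a)) {a..t}"
  proof (rule fundamental_theorem_of_calculus)
    fix x assume "x \<in> {a..t}"
    then show "(f has_vector_derivative deriv_on {a..b} f x) (at x within {a..t})"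
      using has_vector_derivative_deriv_on [OF assms(1), of x] assms(2)
      by (auto intro: has_vector_derivative_within_subset)
  qed (use assms in auto)
  then show ?thesis by (simp add: integral_unique)
qed

lemma has_vector_derivative_cong_on:
  assumes "\<And>s. s \<in> S \<Longrightarrow> f s = g s" "t \<in> S"
  shows "(f has_vector_derivative d) (at t within S) \<longleftrightarrow> (g has_vector_derivative d) (at t within S)"
  using has_vector_derivative_transform [of t S g f d] has_vector_derivative_transform [of t S f g d] assms
  by metis

lemma Ck_on_cong:
  assumes "\<And>t. t \<in> S \<Longrightarrow> f t = g t"
  shows "Ck_on k S f \<longleftrightarrow> Ck_on k S g"
  using assms
proof (induction k arbitrary: f g)
  case (Suc k)
  have eq: "(f has_vector_derivative d) (at t within S) \<longleftrightarrow> (g has_vector_derivative d) (at t within S)"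
    if "t \<in> S" for t d
    by (rule has_vector_derivative_cong_on) (use Suc.prems that in auto)
  \<comment> \<open>\<open>vector_derivative\<close> is a choice among all derivatives; as both
    functions have the same ones, equality holds also where none exists.\<close>
  then have "deriv_on S f t = deriv_on S g t" if "t \<in> S" for t
    using that by (simp add: deriv_on_def vector_derivative_def)
  then have "Ck_on k S (deriv_on S f) \<longleftrightarrow> Ck_on k S (deriv_on S g)" by (rule Suc.IH)
  moreover have "f differentiable (at t within S) \<longleftrightarrow> g differentiable (at t within S)" if "t \<in> S" for t
    using eq [OF that] unfolding vector_derivative_works by (blast intro: differentiableI_vector [unfolded vector_derivative_works])
  ultimately show ?case by auto
qed (simp cong: continuous_on_cong)

lemma deriv_on_eqI:
  assumes "a < b" "t \<in> {a..b}" "(f has_vector_derivative d) (at t within {a..b})"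
  shows "deriv_on {a..b} f t = d"
  using assms vector_derivative_within_cbox [of a b t f d] by (simp add: deriv_on_def)

text \<open>On a nondegenerate interval derivatives are unique, so an explicit \<open>f'\<close>
  agrees with \<open>deriv_on\<close> there and the remaining regularity can be checked on
  \<open>f'\<close>.\<close>

lemma Ck_on_SucI:
  assumes "a < b" and f: "\<And>t. t \<in> {a..b} \<Longrightarrow> (f has_vector_derivative f' t) (at t within {a..b})"
    and f': "Ck_on k {a..b} f'"
  shows "Ck_on (Suc k) {a..b} f"
proof -
  have "Ck_on k {a..b} (deriv_on {a..b} f)"
    using f' Ck_on_cong [of "{a..b}" "deriv_on {a..b} f" f'] deriv_on_eqI [OF \<open>a < b\<close> _ f] by blast
  then show ?thesis
    using differentiableI_vector [OF f] by simp
qed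

subsection \<open>The resolvent of the scalar Volterra equation\<close>

lemma integral_monomial:
  fixes t :: real
  assumes "0 \<le> t"
  shows "((\<lambda>s. s ^ m / fact m) has_integral t ^ Suc m / fact (Suc m)) {0..t}"
proof -
  have "((\<lambda>s. s ^ m / fact m) has_integral t ^ Suc m / fact (Suc m) - 0 ^ Suc m / fact (Suc m)) {0..t}"
  proof (rule fundamental_theorem_of_calculus)
    fix x :: real
    have "real (Suc m) * x ^ m / fact (Suc m) = x ^ m / fact m"
      by (simp del: of_nat_Suc)
    then have "((\<lambda>s. s ^ Suc m / fact (Suc m)) has_real_derivative x ^ m / fact m) (at x within {0..t})"
      using DERIV_cdivide [OF DERIV_pow [of "Suc m" x "{0..t}"], of "fact (Suc m)"] by simp
    then show "((\<lambda>s. s ^ Suc m / fact (Suc m)) has_vector_derivative x ^ m / fact m) (at x within {0..t})"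
      by (simp only: has_real_derivative_iff_has_vector_derivative)
  qed fact
  then show ?thesis by simp
qed

text \<open>This is the solution of \<open>E = 1 + \<mu> (h1 * E)\<close>, the response of the
  Volterra equation to the constant 1. Its value at \<open>T\<close> is the denominator of
  \<open>c_coeff\<close>, its value at \<open>T - s\<close> the weight in the numerator.\<close>

definition resolvent_primitive :: "(real \<Rightarrow> real) \<Rightarrow> real \<Rightarrow> real \<Rightarrow> real" where
  "resolvent_primitive l \<mu> t = 1 + \<mu> * integral {0..t} (resolvent_kernel l \<mu>)"

text \<open>The data for a single eigenvalue \<open>\<mu>\<close>; the locale is interpreted at each
  \<open>lam j\<close>.\<close>

locale memory_kernel =
  fixes T :: real and l :: "real \<Rightarrow> real" and \<mu> :: real
  assumes T: "T > 0"
    and l_C1: "Ck_on 1 {0..T} l" and l_nonneg: "\<And>t. t \<in> {0..T} \<Longrightarrow> l t \<ge> 0" and l_0: "l 0 = 0"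
    and \<mu>: "\<mu> > 0"
begin

abbreviation "M \<equiv> M_const T l"
abbreviation "h \<equiv> deriv_on {0..T} l"
abbreviation "k \<equiv> resolvent_kernel l \<mu>"
abbreviation "E \<equiv> resolvent_primitive l \<mu>"

lemma l_cont: "continuous_on {0..T} l"
  using l_C1 by (rule Ck_on_imp_continuous_on)

lemma h_cont: "continuous_on {0..T} h"
  using l_C1 by simp

lemma l_eq: "t \<in> {0..T} \<Longrightarrow> l t = vconv (\<lambda>_. 1) h t"
  using Ck_on_Suc_imp_integral_deriv_on [of 0 0 T l t] l_C1 l_0 by (simp add: vconv_1)

lemma h1_eq: "h1 l t = vconv (\<lambda>_. 1) l t"
  by (simp add: h1_def vconv_1)

lemma h1_cont: "continuous_on {0..T} (h1 l)"
  unfolding h1_eq [abs_def] by (intro continuous_on_vconv continuous_intros l_cont)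

lemma M_nonneg: "M \<ge> 0"
  unfolding M_const_def using T h_cont
  by (intro mult_nonneg_nonneg integral_nonneg integrable_continuous_real continuous_intros) auto

lemma h1_nonneg: "t \<in> {0..T} \<Longrightarrow> 0 \<le> h1 l t"
  unfolding h1_def
  by (intro integral_nonneg integrable_continuous_real continuous_on_subset [OF l_cont] l_nonneg) auto

text \<open>As \<open>l 0 = 0\<close>, \<open>l\<close> is bounded by the integral of
  \<open>\<bar>h\<bar>\<close>; integrating once more over an interval of length
  \<open>t \<le> T\<close> gives the factor \<open>T\<close> in \<open>M\<close>.\<close>

lemma h1_le: 
  assumes t: "t \<in> {0..T}"
  shows "h1 l t \<le> M"
proof -
  let ?N = "integral {0..T} (\<lambda>t. \<bar>h t\<bar>)"
  have ih: "(\<lambda>t. \<bar>h t\<bar>) integrable_on {0..s}" if "s \<in> {0..T}" for s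
    by (intro integrable_continuous_real continuous_intros continuous_on_subset [OF h_cont]) (use that in auto)
  have N0: "0 \<le> ?N" by (intro integral_nonneg ih) (use T in auto)
  have "norm (l s) \<le> ?N" if s: "s \<in> {0..t}" for s
  proof -
    have s': "s \<in> {0..T}" using s t by auto
    have "norm (l s) = norm (integral {0..s} h)" by (simp add: l_eq [OF s'] vconv_1)
    also have "\<dots> \<le> integral {0..s} (\<lambda>t. \<bar>h t\<bar>)"
      by (intro integral_norm_bound_integral ih integrable_continuous_real continuous_on_subset [OF h_cont])
        (use s' in auto)
    also have "\<dots> \<le> ?N"
      by (intro integral_subset_le ih) (use s' in auto)
    finally show ?thesis .
  qed
  then have "norm (vconv (\<lambda>_. 1) l t) \<le> 1 * ?N * t"
    by (intro norm_vconv_le [OF _ l_cont]) (use t in auto)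
  also have "\<dots> \<le> M" using t N0 by (simp add: M_const_def mult.commute mult_right_mono)
  finally show ?thesis by (simp add: h1_eq)
qed

section \<open>Iterated kernels and the Neumann series\<close>

lemma iterated_kernel_cont: "continuous_on {0..T} (iterated_kernel l m)"
  by (induction m) (auto simp: conv_eq_vconv intro: continuous_on_vconv h1_cont)

text \<open>Each convolution with \<open>h1 \<le> M\<close> contributes a factor \<open>M\<close>
  and integrates the monomial \<open>s ^ m / fact m\<close>. Index \<open>m\<close> stands for
  \<open>m + 1\<close> factors, hence \<open>M ^ Suc m\<close> but only \<open>t ^ m\<close>: the
  first factor comes without an integration.\<close>

lemma iterated_kernel_bounds:
  "t \<in> {0..T} \<Longrightarrow> 0 \<le> iterated_kernel l m t \<and> iterated_kernel l m t \<le> M ^ Suc m * (t ^ m / fact m)"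
proof (induction m arbitrary: t)
  case 0
  then show ?case using h1_nonneg h1_le by simp
next
  case (Suc m)
  let ?g = "\<lambda>s. h1 l (t - s) *\<^sub>R iterated_kernel l m s"
  have int: "?g integrable_on {0..t}"
    by (rule integrable_vconv [OF h1_cont iterated_kernel_cont Suc.prems])
  have b: "0 \<le> ?g s \<and> ?g s \<le> M ^ Suc (Suc m) * (s ^ m / fact m)" if "s \<in> {0..t}" for s
  proof -
    have s: "s \<in> {0..T}" "t - s \<in> {0..T}" using that Suc.prems by auto
    have "?g s \<le> M * (M ^ Suc m * (s ^ m / fact m))"
      using Suc.IH [OF s(1)] h1_nonneg [OF s(2)] h1_le [OF s(2)] M_nonneg
      by (simp only: real_scaleR_def) (intro mult_mono, auto)
    then show ?thesis using Suc.IH [OF s(1)] h1_nonneg [OF s(2)] by simp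
  qed
  have "((\<lambda>s. M ^ Suc (Suc m) * (s ^ m / fact m)) has_integral M ^ Suc (Suc m) * (t ^ Suc m / fact (Suc m))) {0..t}"
    by (intro has_integral_mult_right integral_monomial) (use Suc.prems in auto)
  then have "integral {0..t} ?g \<le> M ^ Suc (Suc m) * (t ^ Suc m / fact (Suc m))"
    by (rule has_integral_le [OF integrable_integral [OF int]]) (use b in blast)
  moreover have "0 \<le> integral {0..t} ?g" by (rule integral_nonneg [OF int]) (use b in blast)
  ultimately show ?case by (simp add: conv_eq_vconv vconv_def)
qed

text \<open>The upper bounds are the terms of the series of \<open>M * exp (\<mu> * M * t)\<close>;
  they give both the convergence of the Neumann series and the bound on its sum.\<close>

lemma resolvent_kernel_terms:
  assumes t: "t \<in> {0..T}"
  shows "0 \<le> \<mu> ^ m * iterated_kernel l m t"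
    and "\<mu> ^ m * iterated_kernel l m t \<le> M * ((\<mu> * M * t) ^ m / fact m)"
proof -
  show "0 \<le> \<mu> ^ m * iterated_kernel l m t"
    using iterated_kernel_bounds [OF t, of m] \<mu> by simp
  have "\<mu> ^ m * iterated_kernel l m t \<le> \<mu> ^ m * (M ^ Suc m * (t ^ m / fact m))"
    by (rule mult_left_mono) (use iterated_kernel_bounds [OF t, of m] \<mu> in auto)
  then show "\<mu> ^ m * iterated_kernel l m t \<le> M * ((\<mu> * M * t) ^ m / fact m)"
    by (simp add: power_mult_distrib mult_ac)
qed

lemma exp_terms_sums: "(\<lambda>m. M * (x ^ m / fact m)) sums (M * exp x)" for x :: real
  using sums_mult [OF exp_converges [of x], of M] by (simp add: divide_inverse mult.commute)

lemma resolvent_kernel_uniform_limit: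
  "uniform_limit {0..T} (\<lambda>n t. \<Sum>m<n. \<mu> ^ m * iterated_kernel l m t) k sequentially"
  unfolding resolvent_kernel_def [abs_def]
proof (rule Weierstrass_m_test)
  fix m t assume t: "t \<in> {0..T}"
  have "(\<mu> * M * t) ^ m \<le> (\<mu> * M * T) ^ m"
    using t \<mu> M_nonneg by (intro power_mono mult_left_mono) auto
  then have "M * ((\<mu> * M * t) ^ m / fact m) \<le> M * ((\<mu> * M * T) ^ m / fact m)"
    using M_nonneg by (intro mult_left_mono divide_right_mono) auto
  then show "norm (\<mu> ^ m * iterated_kernel l m t) \<le> M * ((\<mu> * M * T) ^ m / fact m)"
    using resolvent_kernel_terms [OF t, of m] by simp
qed (rule sums_summable [OF exp_terms_sums])

lemma k_cont: "continuous_on {0..T} k"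
  by (rule uniform_limit_theorem [OF _ resolvent_kernel_uniform_limit])
    (auto intro!: always_eventually continuous_intros iterated_kernel_cont)

lemma k_sums: "t \<in> {0..T} \<Longrightarrow> (\<lambda>m. \<mu> ^ m * iterated_kernel l m t) sums k t"
  using tendsto_uniform_limitI [OF resolvent_kernel_uniform_limit] by (auto simp: sums_def)

lemma k_bounds:
  assumes t: "t \<in> {0..T}"
  shows "0 \<le> k t" "k t \<le> M * exp (\<mu> * M * t)"
  using sums_le [OF _ sums_zero k_sums [OF t]] sums_le [OF _ k_sums [OF t] exp_terms_sums]
    resolvent_kernel_terms [OF t] by auto

text \<open>Convolving a partial sum of the Neumann series with \<open>h1\<close> raises every index
  by one, so \<open>h1 + \<mu> (h1 * S n) = S (n + 1)\<close>; uniform convergence allows the limit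
  on both sides.\<close>

lemma k_eq:
  assumes t: "t \<in> {0..T}"
  shows "k t = h1 l t + \<mu> * vconv (h1 l) k t"
proof -
  let ?S = "\<lambda>n t. \<Sum>m<n. \<mu> ^ m * iterated_kernel l m t"
  have S_cont: "continuous_on {0..T} (?S n)" for n
    by (intro continuous_intros iterated_kernel_cont)
  have "h1 l t + \<mu> * vconv (h1 l) (?S n) t = ?S (Suc n) t" for n
  proof -
    have "vconv (h1 l) (?S n) t = (\<Sum>m<n. \<mu> ^ m * iterated_kernel l (Suc m) t)"
    proof (induction n)
      case (Suc n)
      have "vconv (h1 l) (\<lambda>s. \<mu> ^ n * iterated_kernel l n s) t = \<mu> ^ n * vconv (h1 l) (iterated_kernel l n) t"
        by (rule vconv_linear [OF bounded_linear_mult_right h1_cont iterated_kernel_cont t])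
      then show ?case
        using Suc vconv_add_right [OF h1_cont S_cont _ t, of "\<lambda>s. \<mu> ^ n * iterated_kernel l n s" n]
        by (simp add: conv_eq_vconv continuous_on_mult_left iterated_kernel_cont)
    qed (simp add: vconv_def)
    then show ?thesis
      by (subst sum.lessThan_Suc_shift) (simp add: sum_distrib_left mult_ac)
  qed
  moreover have "(\<lambda>n. h1 l t + \<mu> * vconv (h1 l) (?S n) t) \<longlonglongrightarrow> h1 l t + \<mu> * vconv (h1 l) k t"
    by (intro tendsto_intros tendsto_vconv [OF h1_cont S_cont resolvent_kernel_uniform_limit t])
  moreover have "(\<lambda>n. ?S (Suc n) t) \<longlonglongrightarrow> k t"
    using k_sums [OF t] unfolding sums_def by (rule LIMSEQ_Suc)
  ultimately show ?thesis
    using LIMSEQ_unique by auto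
qed

section \<open>The resolvent primitive: bounds and integral equation\<close>

lemma E_eq_k: "E t = 1 + \<mu> * vconv (\<lambda>_. 1) k t"
  by (simp add: resolvent_primitive_def vconv_1)

lemma E_cont: "continuous_on {0..T} E"
  unfolding E_eq_k [abs_def] by (intro continuous_intros continuous_on_vconv k_cont)

lemma E_ge_1:
  assumes "t \<in> {0..T}"
  shows "1 \<le> E t"
proof -
  have "0 \<le> integral {0..t} k"
    by (intro integral_nonneg integrable_continuous_real continuous_on_subset [OF k_cont] k_bounds)
      (use assms in auto)
  then show ?thesis using \<mu> by (simp add: resolvent_primitive_def)
qed

text \<open>The bound \<open>M * exp (\<mu> * M * s)\<close> on \<open>k\<close>, multiplied by
  \<open>\<mu>\<close>, is the derivative of \<open>exp (\<mu> * M * s)\<close>; the value 1 of this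
  function at 0 cancels against the 1 in \<open>E\<close>.\<close>

lemma E_le_exp:
  assumes t: "t \<in> {0..T}"
  shows "E t \<le> exp (\<mu> * M * T)"
proof -
  have "((\<lambda>s. \<mu> * (M * exp (\<mu> * M * s))) has_integral exp (\<mu> * M * t) - exp (\<mu> * M * 0)) {0..t}"
    by (rule fundamental_theorem_of_calculus)
      (use t in \<open>auto intro!: derivative_eq_intros simp flip: has_real_derivative_iff_has_vector_derivative\<close>)
  from _ this have "\<mu> * integral {0..t} k \<le> exp (\<mu> * M * t) - exp (\<mu> * M * 0)"
  proof (rule has_integral_le)
    show "((\<lambda>s. \<mu> * k s) has_integral \<mu> * integral {0..t} k) {0..t}"
      by (intro has_integral_mult_right integrable_integral integrable_continuous_real continuous_on_subset [OF k_cont])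
        (use t in auto)
  qed (use t \<mu> k_bounds in auto)
  moreover have "exp (\<mu> * M * t) \<le> exp (\<mu> * M * T)"
    using t \<mu> M_nonneg by (simp add: mult_left_mono)
  ultimately have "\<mu> * integral {0..t} k \<le> exp (\<mu> * M * T) - 1"
    unfolding mult_zero_right exp_zero by linarith
  then show ?thesis by (simp add: resolvent_primitive_def)
qed

text \<open>With \<open>h1 * 1 = 1 * h1\<close> and associativity,
  \<open>h1 * E = 1 * (h1 + \<mu> (h1 * k)) = 1 * k\<close>, the last equality by
  \<open>k_eq\<close>.\<close>

lemma E_eq:
  assumes t: "t \<in> {0..T}"
  shows "E t = 1 + \<mu> * vconv (h1 l) E t"
proof -
  have one: "continuous_on {0..T} (\<lambda>_. 1::real)" by simp
  note hk = continuous_on_vconv [OF h1_cont k_cont]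
  have "vconv (h1 l) E t = vconv (h1 l) (\<lambda>_. 1) t + vconv (h1 l) (\<lambda>s. \<mu> * vconv (\<lambda>_. 1) k s) t"
    unfolding E_eq_k [abs_def]
    by (rule vconv_add_right [OF h1_cont _ _ t]) (intro continuous_intros continuous_on_vconv k_cont)+
  also have "vconv (h1 l) (\<lambda>s. \<mu> * vconv (\<lambda>_. 1) k s) t = \<mu> * vconv (h1 l) (vconv (\<lambda>_. 1) k) t"
    by (rule vconv_linear [OF bounded_linear_mult_right h1_cont continuous_on_vconv [OF one k_cont] t])
  also have "vconv (h1 l) (vconv (\<lambda>_. 1) k) t = vconv (vconv (h1 l) (\<lambda>_. 1)) k t"
    by (rule vconv_assoc [OF h1_cont one k_cont t, symmetric])
  also have "\<dots> = vconv (vconv (\<lambda>_. 1) (h1 l)) k t"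
    by (rule vconv_cong) (auto intro: vconv_commute)
  also have "\<dots> = vconv (\<lambda>_. 1) (vconv (h1 l) k) t"
    by (rule vconv_assoc [OF one h1_cont k_cont t])
  also have "vconv (h1 l) (\<lambda>_. 1) t = vconv (\<lambda>_. 1) (h1 l) t"
    by (rule vconv_commute)
  also have "\<mu> * vconv (\<lambda>_. 1) (vconv (h1 l) k) t = vconv (\<lambda>_. 1) (\<lambda>s. \<mu> * vconv (h1 l) k s) t"
    by (rule vconv_linear [OF bounded_linear_mult_right one hk t, symmetric])
  also have "vconv (\<lambda>_. 1) (h1 l) t + \<dots> = vconv (\<lambda>_. 1) (\<lambda>s. h1 l s + \<mu> * vconv (h1 l) k s) t"
    by (rule vconv_add_right [OF one h1_cont _ t, symmetric]) (intro continuous_intros hk)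
  also have "\<dots> = vconv (\<lambda>_. 1) k t"
    by (rule vconv_cong) (use t in \<open>auto simp: k_eq [symmetric]\<close>)
  finally show ?thesis using E_eq_k [of t] by simp
qed

text \<open>Convolving the equation with \<open>k\<close> and using \<open>\<mu> (k * h\<^sub>1) = k - h\<^sub>1\<close> yields \<open>h\<^sub>1 * d = (1 * k) c\<close>.\<close>

lemma volterra_unique:
  fixes d :: "real \<Rightarrow> 'b::banach"
  assumes d: "continuous_on {0..T} d"
    and eq: "\<And>t. t \<in> {0..T} \<Longrightarrow> d t = c + \<mu> *\<^sub>R vconv (h1 l) d t"
    and t: "t \<in> {0..T}"
  shows "d t = E t *\<^sub>R c"
proof -
  note hd = continuous_on_vconv [OF h1_cont d]
  have "vconv k d t = vconv k (\<lambda>s. c + \<mu> *\<^sub>R vconv (h1 l) d s) t"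
    by (rule vconv_cong) (use eq t in auto)
  also have "\<dots> = vconv k (\<lambda>_. c) t + vconv k (\<lambda>s. \<mu> *\<^sub>R vconv (h1 l) d s) t"
    by (rule vconv_add_right [OF k_cont _ _ t]) (intro continuous_intros hd)+
  also have "vconv k (\<lambda>_. c) t = integral {0..t} k *\<^sub>R c"
    by (rule vconv_const [OF k_cont t])
  also have "vconv k (\<lambda>s. \<mu> *\<^sub>R vconv (h1 l) d s) t = \<mu> *\<^sub>R vconv k (vconv (h1 l) d) t"
    by (rule vconv_linear [OF bounded_linear_scaleR_right k_cont hd t])
  also have "vconv k (vconv (h1 l) d) t = vconv (vconv k (h1 l)) d t"
    by (rule vconv_assoc [OF k_cont h1_cont d t, symmetric])
  also have "\<mu> *\<^sub>R \<dots> = vconv (\<lambda>s. \<mu> * vconv k (h1 l) s) d t"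
    by (rule vconv_scale_left [symmetric])
  also have "\<dots> = vconv (\<lambda>s. k s + - 1 * h1 l s) d t"
    by (rule vconv_cong) (use t in \<open>auto simp: k_eq vconv_commute [of k]\<close>)
  also have "\<dots> = vconv k d t + vconv (\<lambda>s. - 1 * h1 l s) d t"
    by (rule vconv_add_left [OF k_cont _ d t]) (intro continuous_intros h1_cont)
  also have "vconv (\<lambda>s. - 1 * h1 l s) d t = - vconv (h1 l) d t"
    by (simp only: vconv_scale_left) simp
  \<comment> \<open>\<open>vconv k d t\<close> now stands on both sides and cancels.\<close>
  finally have "vconv (h1 l) d t = integral {0..t} k *\<^sub>R c"
    by (simp add: algebra_simps)
  then show ?thesis
    using eq [OF t] by (simp add: resolvent_primitive_def scaleR_add_left)
qed

text \<open>Multiplying \<open>E_eq\<close> by \<open>c\<close> and convolving it with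
  \<open>f\<close> gives one equation for each summand of \<open>y\<close>, with free terms
  \<open>c\<close> and \<open>1 * f\<close>.\<close>

lemma volterra_solution:
  fixes f :: "real \<Rightarrow> 'b::banach" and c :: 'b
  assumes f: "continuous_on {0..T} f" and t: "t \<in> {0..T}"
  defines "y \<equiv> \<lambda>t. E t *\<^sub>R c + vconv E f t"
  shows "y t = c + integral {0..t} f + \<mu> *\<^sub>R vconv (h1 l) y t"
proof -
  have one: "continuous_on {0..T} (\<lambda>_. 1::real)" by simp
  have Ec: "continuous_on {0..T} (\<lambda>s. E s *\<^sub>R c)" by (intro continuous_intros E_cont)
  have "vconv E f t = vconv (\<lambda>s. 1 + \<mu> * vconv (h1 l) E s) f t"
    by (rule vconv_cong) (use t E_eq in auto)
  also have "\<dots> = vconv (\<lambda>_. 1) f t + vconv (\<lambda>s. \<mu> * vconv (h1 l) E s) f t"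
    by (intro vconv_add_left [OF one _ f t] continuous_intros continuous_on_vconv h1_cont E_cont)
  also have "vconv (\<lambda>s. \<mu> * vconv (h1 l) E s) f t = \<mu> *\<^sub>R vconv (h1 l) (vconv E f) t"
    by (simp add: vconv_scale_left vconv_assoc [OF h1_cont E_cont f t])
  finally have 1: "vconv E f t = integral {0..t} f + \<mu> *\<^sub>R vconv (h1 l) (vconv E f) t"
    by (simp add: vconv_1)
  have "vconv (h1 l) y t = vconv (h1 l) (\<lambda>s. E s *\<^sub>R c) t + vconv (h1 l) (vconv E f) t"
    unfolding y_def by (rule vconv_add_right [OF h1_cont Ec continuous_on_vconv [OF E_cont f] t])
  also have "vconv (h1 l) (\<lambda>s. E s *\<^sub>R c) t = vconv (h1 l) E t *\<^sub>R c"
    by (rule vconv_linear [OF bounded_linear_scaleR_left h1_cont E_cont t])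
  finally have 2: "vconv (h1 l) y t = vconv (h1 l) E t *\<^sub>R c + vconv (h1 l) (vconv E f) t" .
  show ?thesis
    unfolding 2 using E_eq [OF t] 1 by (simp add: y_def algebra_simps)
qed

text \<open>Associativity for \<open>h1 = 1 * l\<close>. It links the Volterra equation of a
  coefficient with the time integral of the memory term.\<close>

lemma vconv_h1:
  assumes "continuous_on {0..T} y" "t \<in> {0..T}"
  shows "vconv (h1 l) y t = integral {0..t} (vconv l y)"
  unfolding h1_eq [abs_def] vconv_1 [of "vconv l y", symmetric]
  by (rule vconv_assoc [OF _ l_cont assms]) simp

text \<open>\<open>c_coeff\<close> is this equation solved for the initial value, which is possible
  since \<open>E T \<ge> 1\<close>.\<close>

lemma mode_terminal_value:
  fixes a :: "'k::rc_scalar" and b :: "real \<Rightarrow> 'k"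
  shows "E T *\<^sub>R c_coeff T l \<mu> a b + vconv E b T = a"
proof -
  have "E T \<noteq> 0" using E_ge_1 [of T] T by auto
  moreover have "vconv E b T = integral {0..T} (\<lambda>s. b s * of_real (E (T - s)))"
    by (simp add: vconv_def scaleR_conv_of_real mult.commute)
  ultimately show ?thesis
    unfolding c_coeff_def resolvent_primitive_def [symmetric] by (simp add: scaleR_conv_of_real)
qed

text \<open>\<open>E\<close> is at most \<open>exp (\<mu> * M * T)\<close> and
  \<open>norm (b s)\<close> at most the root of the supremum in \<open>L_coeff\<close>; squaring
  doubles the exponent and produces the weight of the summability hypothesis.\<close>

lemma mode_bound:
  fixes a :: "'k::rc_scalar" and b :: "real \<Rightarrow> 'k"
  assumes b: "continuous_on {0..T} b" and t: "t \<in> {0..T}"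
  shows "(norm (E t *\<^sub>R c_coeff T l \<mu> a b + vconv E b t))\<^sup>2
    \<le> 2 * (1 + T\<^sup>2) * (L_coeff T l \<mu> a b * exp (2 * \<mu> * M * T))"
proof -
  let ?c = "c_coeff T l \<mu> a b"
  let ?X = "exp (\<mu> * M * T)"
  define S where "S = (SUP t\<in>{0..T}. (norm (b t))\<^sup>2)"
  have "bdd_above ((\<lambda>t. (norm (b t))\<^sup>2) ` {0..T})"
    by (intro bounded_imp_bdd_above compact_imp_bounded compact_continuous_image continuous_intros b) auto
  then have S: "(norm (b s))\<^sup>2 \<le> S" if "s \<in> {0..T}" for s
    unfolding S_def using that by (intro cSUP_upper)
  have S0: "0 \<le> S" using S [OF t] by (meson order_trans zero_le_power2)
  have bs: "norm (b s) \<le> sqrt S" if "s \<in> {0..T}" for s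
    using S [OF that] by (intro real_le_rsqrt)
  have X: "norm (vconv E b t) \<le> ?X * sqrt S * t"
    by (rule norm_vconv_le [OF E_cont b _ _ t]) (use E_le_exp E_ge_1 bs t in \<open>force\<close>)+
  also have "\<dots> \<le> ?X * sqrt S * T" using t S0 by (intro mult_left_mono) auto
  finally have 1: "norm (vconv E b t) \<le> ?X * (T * sqrt S)" by (simp add: mult_ac)
  have 2: "norm (E t *\<^sub>R ?c) \<le> ?X * norm ?c"
    using E_le_exp [OF t] E_ge_1 [OF t] by (simp add: mult_right_mono)
  have "norm (E t *\<^sub>R ?c + vconv E b t) \<le> ?X * (norm ?c + T * sqrt S)"
    using norm_triangle_ineq [of "E t *\<^sub>R ?c" "vconv E b t"] 1 2 by (simp add: algebra_simps)
  then have "(norm (E t *\<^sub>R ?c + vconv E b t))\<^sup>2 \<le> (?X * (norm ?c + T * sqrt S))\<^sup>2"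
    by (rule power_mono) simp
  also have "\<dots> = ?X\<^sup>2 * (norm ?c + T * sqrt S)\<^sup>2" by (rule power_mult_distrib)
  also have "\<dots> \<le> ?X\<^sup>2 * (2 * (1 + T\<^sup>2) * L_coeff T l \<mu> a b)"
  proof (rule mult_left_mono)
    have "(norm ?c + T * sqrt S)\<^sup>2 \<le> 2 * (norm ?c)\<^sup>2 + 2 * (T * sqrt S)\<^sup>2"
      using sum_squares_bound [of "norm ?c" "T * sqrt S"] by (simp add: power2_sum)
    also have "\<dots> = 2 * (norm ?c)\<^sup>2 + 2 * T\<^sup>2 * S" using S0 by (simp add: power_mult_distrib)
    \<comment> \<open>The constant dominates both coefficients, 2 and
      \<open>2 * T\<^sup>2\<close>.\<close>
    also have "\<dots> \<le> 2 * (1 + T\<^sup>2) * ((norm a)\<^sup>2 + (norm ?c)\<^sup>2 + S)"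
      using S0 by (simp add: algebra_simps add_nonneg_nonneg)
    finally show "(norm ?c + T * sqrt S)\<^sup>2 \<le> 2 * (1 + T\<^sup>2) * L_coeff T l \<mu> a b"
      by (simp add: L_coeff_def S_def)
  qed simp
  also have "?X\<^sup>2 = exp (2 * \<mu> * M * T)" by (simp add: power2_eq_square flip: exp_add)
  finally show ?thesis by (simp add: mult_ac)
qed

end

subsection \<open>Orthonormal series and selfadjoint operators\<close>

lemma cnj_scalar_0 [simp]: "cnj_scalar (0::'k::rc_scalar) = 0"
  using cnj_scalar_add [of "0::'k" 0] by simp

text \<open>The product axiom solved for the conjugate; with this formula multiplicativity and the
  values on the reals become field algebra. At 0, where the product axiom says nothing, the value
  comes from additivity.\<close>

lemma cnj_scalar_eq: "x \<noteq> 0 \<Longrightarrow> cnj_scalar x = (norm x)\<^sup>2 *\<^sub>R inverse x" for x :: "'k::rc_scalar"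
  using mult_cnj_scalar [of x] by (simp add: scaleR_conv_of_real field_simps)

lemma cnj_scalar_mult: "cnj_scalar (x * y) = cnj_scalar x * cnj_scalar y" for x y :: "'k::rc_scalar"
  by (cases "x = 0 \<or> y = 0")
    (auto simp: cnj_scalar_eq norm_mult power_mult_distrib mult_ac)

lemma cnj_scalar_of_real [simp]: "cnj_scalar (of_real r) = (of_real r :: 'k::rc_scalar)"
  by (cases "r = 0")
    (auto simp: cnj_scalar_eq scaleR_conv_of_real power2_eq_square simp flip: of_real_mult of_real_inverse)

section \<open>The scalar product and its norm\<close>

context hilbert_space
begin

lemma ip_add_right: "ip x (y + z) = ip x y + ip x z"
  by (metis ip_commute ip_add_left cnj_scalar_add)

lemma ip_scale_right: "ip x (smul c y) = cnj_scalar c * ip x y"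
  by (metis ip_commute ip_scale_left cnj_scalar_mult)

lemma ip_scaleR_left: "ip (r *\<^sub>R x) y = r *\<^sub>R ip x y"
  by (simp add: scale_of_real [symmetric] ip_scale_left scaleR_conv_of_real)

lemma ip_scaleR_right: "ip x (r *\<^sub>R y) = r *\<^sub>R ip x y"
  by (simp add: scale_of_real [symmetric] ip_scale_right scaleR_conv_of_real)

lemma ip_zero_left [simp]: "ip 0 x = 0"
  using ip_scaleR_left [of 0 0 x] by simp

lemma ip_zero_right [simp]: "ip x 0 = 0"
  using ip_scaleR_right [of x 0 0] by simp

lemma ip_minus_left: "ip (- x) y = - ip x y"
  using ip_scaleR_left [of "- 1" x y] by simp

lemma ip_diff_left: "ip (x - y) z = ip x z - ip y z"
  using ip_add_left [of x "- y" z] by (simp add: ip_minus_left)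

lemma ip_minus_right: "ip x (- y) = - ip x y"
  using ip_scaleR_right [of x "- 1" y] by simp

lemma ip_diff_right: "ip x (y - z) = ip x y - ip x z"
  using ip_add_right [of x y "- z"] by (simp add: ip_minus_right)

text \<open>Cauchy-Schwarz, by expanding the squared norm of \<open>x - smul c y\<close>, where
  \<open>smul c y\<close> is the projection of \<open>x\<close> onto the line of \<open>y\<close>.
  The computation takes place in \<open>'k\<close>, and injectivity of \<open>of_real\<close> brings
  it back to the reals.\<close>

lemma norm_ip_le: "norm (ip x y) \<le> norm x * norm y"
proof (cases "y = 0")
  case False
  define n where "n = (norm y)\<^sup>2"
  have n: "n > 0" using False by (simp add: n_def)
  define c where "c = ip x y / of_real n"
  have cc: "c * cnj_scalar c = of_real ((norm c)\<^sup>2)" for c :: 'k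
    by (simp add: mult_cnj_scalar scaleR_conv_of_real)
  have 1: "c * of_real n = ip x y" using n by (simp add: c_def)
  have "cnj_scalar c * ip x y = cnj_scalar c * c * of_real n" by (simp add: 1 [symmetric] mult_ac)
  then have 2: "cnj_scalar c * ip x y = of_real ((norm c)\<^sup>2 * n)" using cc [of c] by (simp add: mult.commute)
  have "c * ip y x = c * cnj_scalar (c * of_real n)" by (metis 1 ip_commute)
  then have 3: "c * ip y x = of_real ((norm c)\<^sup>2 * n)"
    using cc [of c] by (simp add: cnj_scalar_mult flip: mult.assoc)
  have "of_real ((norm (x - smul c y))\<^sup>2) = ip (x - smul c y) (x - smul c y)" by (simp only: ip_self)
  also have "\<dots> = ip x x - c * ip y x - cnj_scalar c * ip x y + c * cnj_scalar c * ip y y"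
    by (simp add: ip_diff_left ip_diff_right ip_scale_left ip_scale_right algebra_simps)
  also have "\<dots> = of_real ((norm x)\<^sup>2 - (norm c)\<^sup>2 * n)"
    unfolding 2 3 cc ip_self n_def [symmetric] by simp
  finally have "(norm (x - smul c y))\<^sup>2 = (norm x)\<^sup>2 - (norm c)\<^sup>2 * n"
    by (simp only: of_real_eq_iff)
  then have "(norm c)\<^sup>2 * n \<le> (norm x)\<^sup>2" by (metis diff_ge_0_iff_ge zero_le_power2)
  \<comment> \<open>A further factor \<open>n\<close> turns the left side into
    \<open>(norm (ip x y))\<^sup>2\<close>, as \<open>c * of_real n = ip x y\<close>.\<close>
  then have "((norm c)\<^sup>2 * n) * n \<le> (norm x)\<^sup>2 * n" using n by (intro mult_right_mono) auto
  also have "((norm c)\<^sup>2 * n) * n = (norm (c * of_real n))\<^sup>2"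
    using n by (simp add: norm_mult power2_eq_square)
  finally have "(norm (ip x y))\<^sup>2 \<le> (norm x * norm y)\<^sup>2"
    unfolding 1 by (simp add: n_def power_mult_distrib)
  then show ?thesis by (rule power2_le_imp_le) simp
qed simp

lemma bounded_bilinear_ip: "bounded_bilinear ip"
proof
  show "\<exists>K. \<forall>a b. norm (ip a b) \<le> norm a * norm b * K"
    by (rule exI [of _ 1]) (simp add: norm_ip_le)
qed (simp_all add: ip_add_left ip_add_right ip_scaleR_left ip_scaleR_right)

lemmas bounded_linear_ip_left = bounded_bilinear.bounded_linear_left [OF bounded_bilinear_ip]
lemmas tendsto_ip = bounded_bilinear.tendsto [OF bounded_bilinear_ip]

lemma ip_sum_left: "ip (sum g I) y = (\<Sum>i\<in>I. ip (g i) y)"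
  by (induction I rule: infinite_finite_induct) (auto simp: ip_add_left)

lemma ip_sum_right: "ip x (sum g I) = (\<Sum>i\<in>I. ip x (g i))"
  by (induction I rule: infinite_finite_induct) (auto simp: ip_add_right)

lemma smul_scaleR: "smul (r *\<^sub>R c) x = r *\<^sub>R smul c x"
  by (simp add: scaleR_conv_of_real scale_of_real [symmetric])

text \<open>For a general scalar the norm of a multiple is computed through the scalar product,
  pulling \<open>c\<close> out of one argument and its conjugate out of the other.\<close>

lemma norm_smul: "norm (smul c x) = norm c * norm x"
proof -
  have "of_real ((norm (smul c x))\<^sup>2) = c * cnj_scalar c * ip x x"
    unfolding ip_self [symmetric] by (simp add: ip_scale_left ip_scale_right mult_ac)
  also have "\<dots> = of_real ((norm c * norm x)\<^sup>2)"
    unfolding ip_self mult_cnj_scalar by (simp add: scaleR_conv_of_real power_mult_distrib)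
  finally have "(norm (smul c x))\<^sup>2 = (norm c * norm x)\<^sup>2" by (simp only: of_real_eq_iff)
  then show ?thesis by (simp add: power2_eq_iff_nonneg)
qed

lemma bounded_linear_smul_left: "bounded_linear (\<lambda>c. smul c x)"
  by (rule bounded_linear_intro [of _ "norm x"])
    (simp_all add: scale_left_distrib smul_scaleR norm_smul)

section \<open>Orthonormal bases\<close>

context
  fixes \<phi> :: "nat \<Rightarrow> 'a"
  assumes basis: "orthonormal_basis smul ip \<phi>"
begin

lemma ip_basis: "ip (\<phi> i) (\<phi> j) = (if i = j then 1 else 0)"
  using basis by (simp add: orthonormal_basis_def)

text \<open>Such an \<open>x\<close> is orthogonal to the span of the basis; approximating
  \<open>x\<close> itself by elements of this dense span gives \<open>ip x x = 0\<close>.\<close>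

lemma eq_zero_if_coefficients_zero:
  assumes "\<And>j. ip x (\<phi> j) = 0"
  shows "x = 0"
proof -
  have "ip x y = 0" if "y \<in> span (range \<phi>)" for y
    using that by (induction rule: span_induct_alt) (auto simp: ip_add_right ip_scale_right assms)
  moreover have "x \<in> closure (span (range \<phi>))"
    using basis by (simp add: orthonormal_basis_def)
  then obtain s where "\<And>n. s n \<in> span (range \<phi>)" "s \<longlonglongrightarrow> x"
    unfolding closure_sequential by blast
  ultimately have "(\<lambda>n. 0) \<longlonglongrightarrow> ip x x"
    using tendsto_ip [OF tendsto_const [of x], of s x sequentially] by simp
  then have "ip x x = 0" by (simp add: LIMSEQ_const_iff)
  then show ?thesis by (simp add: ip_self)
qed

lemma eqI_coefficients: "(\<And>j. ip x (\<phi> j) = ip y (\<phi> j)) \<Longrightarrow> x = y"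
  using eq_zero_if_coefficients_zero [of "x - y"] by (simp add: ip_diff_left)

lemma ip_basis_sum:
  "finite I \<Longrightarrow> ip (\<Sum>i\<in>I. smul (a i) (\<phi> i)) (\<phi> j) = (if j \<in> I then a j else 0)"
  by (simp add: ip_sum_left ip_scale_left ip_basis if_distrib cong: if_cong)

lemma norm_basis_sum:
  assumes "finite I"
  shows "(norm (\<Sum>i\<in>I. smul (a i) (\<phi> i)))\<^sup>2 = (\<Sum>i\<in>I. (norm (a i))\<^sup>2)"
proof -
  let ?s = "\<Sum>i\<in>I. smul (a i) (\<phi> i)"
  have "of_real ((norm ?s)\<^sup>2) = (\<Sum>i\<in>I. ip ?s (smul (a i) (\<phi> i)))"
    unfolding ip_self [symmetric] by (rule ip_sum_right)
  also have "\<dots> = (\<Sum>i\<in>I. a i * cnj_scalar (a i))"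
    by (intro sum.cong) (simp_all add: ip_scale_right ip_basis_sum assms mult.commute)
  also have "\<dots> = of_real (\<Sum>i\<in>I. (norm (a i))\<^sup>2)"
    by (simp add: mult_cnj_scalar scaleR_conv_of_real)
  finally show ?thesis by (simp only: of_real_eq_iff)
qed

text \<open>By Pythagoras the squared norm of a block of the series is at most the corresponding
  block of \<open>B\<close>, uniformly in \<open>t\<close>, so the partial sums are uniformly
  Cauchy. Their convergence is exported as well, for use with the closedness of
  \<open>A\<close>.\<close>

lemma uniform_limit_basis_series:
  fixes a :: "nat \<Rightarrow> real \<Rightarrow> 'k"
  assumes cont: "\<And>j. continuous_on S (a j)"
    and bound: "\<And>j t. t \<in> S \<Longrightarrow> (norm (a j t))\<^sup>2 \<le> B j" and B: "summable B"
  obtains w where "continuous_on S w" "\<And>j t. t \<in> S \<Longrightarrow> ip (w t) (\<phi> j) = a j t"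
    "\<And>t. t \<in> S \<Longrightarrow> (\<lambda>n. \<Sum>j<n. smul (a j t) (\<phi> j)) \<longlonglongrightarrow> w t"
proof -
  let ?s = "\<lambda>n t. \<Sum>j<n. smul (a j t) (\<phi> j)"
  have "uniformly_Cauchy_on S ?s"
  proof (rule uniformly_Cauchy_onI')
    fix e :: real assume e: "e > 0"
    have "e\<^sup>2 > 0" using e by simp
    then obtain N where N: "\<And>m n. m \<ge> N \<Longrightarrow> norm (sum B {m..<n}) < e\<^sup>2"
      using B unfolding summable_Cauchy by blast
    have "dist (?s m t) (?s n t) < e" if "t \<in> S" "m \<ge> N" "n > m" for t m n
    proof -
      have "?s n t - ?s m t = (\<Sum>j\<in>{m..<n}. smul (a j t) (\<phi> j))"
        using \<open>n > m\<close> by (simp add: sum_diff_nat_ivl lessThan_atLeast0)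
      then have "(norm (?s n t - ?s m t))\<^sup>2 = (\<Sum>j\<in>{m..<n}. (norm (a j t))\<^sup>2)"
        by (simp add: norm_basis_sum)
      also have "\<dots> \<le> sum B {m..<n}" by (intro sum_mono bound that)
      also have "\<dots> < e\<^sup>2" using N [OF \<open>m \<ge> N\<close>, of n] by simp
      finally show ?thesis
        using e by (simp add: dist_norm norm_minus_commute power_less_imp_less_base)
    qed
    then show "\<exists>M. \<forall>x\<in>S. \<forall>m\<ge>M. \<forall>n>m. dist (?s m x) (?s n x) < e" by blast
  qed
  then have "uniformly_convergent_on S ?s" by (rule Cauchy_uniformly_convergent)
  then obtain w where w: "uniform_limit S ?s w sequentially"
    unfolding uniformly_convergent_on_def ..
  have lim: "(\<lambda>n. ?s n t) \<longlonglongrightarrow> w t" if "t \<in> S" for t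
    using tendsto_uniform_limitI [OF w that] .
  show thesis
  proof (rule that)
    have "continuous_on S (?s n)" for n
      by (intro continuous_on_sum bounded_linear.continuous_on [OF bounded_linear_smul_left] cont)
    then show "continuous_on S w"
      by (intro uniform_limit_theorem [OF _ w]) auto
    fix j t assume t: "t \<in> S"
    show "ip (w t) (\<phi> j) = a j t"
    proof (rule LIMSEQ_unique)
      show "(\<lambda>n. ip (?s n t) (\<phi> j)) \<longlonglongrightarrow> ip (w t) (\<phi> j)"
        by (intro tendsto_ip lim t tendsto_const)
      show "(\<lambda>n. ip (?s n t) (\<phi> j)) \<longlonglongrightarrow> a j t"
        by (rule tendsto_eventually, rule eventually_mono [OF eventually_gt_at_top [of j]])
          (simp add: ip_basis_sum)
    qed
  qed (rule lim)
qed

end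

section \<open>Selfadjoint operators\<close>

context
  fixes D :: "'a set" and A :: "'a \<Rightarrow> 'a"
  assumes A: "selfadjoint_operator smul ip D A"
begin

text \<open>The graphs of the operator and its adjoint agree; read from right to left, this yields
  membership in \<open>D\<close> together with the value of \<open>A\<close>.\<close>

lemma selfadjoint_domain_iff: "y \<in> D \<and> A y = z \<longleftrightarrow> (\<forall>x\<in>D. ip (A x) y = ip x z)"
proof -
  have "adjoint_graph ip D A = {(x, A x) | x. x \<in> D}"
    using A by (simp add: selfadjoint_operator_def)
  then have "(y, z) \<in> adjoint_graph ip D A \<longleftrightarrow> (y, z) \<in> {(x, A x) | x. x \<in> D}" by simp
  then show ?thesis by (auto simp: adjoint_graph_def)
qed

lemma selfadjoint_symmetric: "x \<in> D \<Longrightarrow> y \<in> D \<Longrightarrow> ip (A x) y = ip x (A y)"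
  using selfadjoint_domain_iff by blast

text \<open>An adjoint is closed: for each fixed \<open>v\<close> the relation
  \<open>ip (A v) (x n) = ip v (A (x n))\<close> survives the limits of \<open>x n\<close> and
  \<open>A (x n)\<close>.\<close>

lemma selfadjoint_closed:
  assumes "\<And>n. x n \<in> D" "x \<longlonglongrightarrow> y" "(\<lambda>n. A (x n)) \<longlonglongrightarrow> z"
  shows "y \<in> D \<and> A y = z"
  unfolding selfadjoint_domain_iff
proof
  fix v assume v: "v \<in> D"
  have "(\<lambda>n. ip (A v) (x n)) \<longlonglongrightarrow> ip (A v) y"
    by (intro tendsto_ip assms tendsto_const)
  moreover have "(\<lambda>n. ip (A v) (x n)) = (\<lambda>n. ip v (A (x n)))"
    using selfadjoint_symmetric [OF v assms(1)] by simp
  moreover have "(\<lambda>n. ip v (A (x n))) \<longlonglongrightarrow> ip v z"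
    by (intro tendsto_ip assms tendsto_const)
  ultimately show "ip (A v) y = ip v z" by (metis LIMSEQ_unique)
qed

lemma subspace_domain: "subspace D"
  and op_add: "x \<in> D \<Longrightarrow> y \<in> D \<Longrightarrow> A (x + y) = A x + A y"
  and op_smul: "x \<in> D \<Longrightarrow> A (smul c x) = smul c (A x)"
  using A by (auto simp: selfadjoint_operator_def)

lemma op_diff:
  assumes "x \<in> D" "y \<in> D"
  shows "x - y \<in> D" "A (x - y) = A x - A y"
  using assms subspace_diff [OF subspace_domain] op_add [of x "smul (- 1) y"] op_smul [of y "- 1"]
    subspace_scale [OF subspace_domain, of y "- 1"]
  by auto

lemma op_sum:
  assumes "\<And>i. i \<in> I \<Longrightarrow> x i \<in> D"
  shows "(\<Sum>i\<in>I. smul (c i) (x i)) \<in> D \<and> A (\<Sum>i\<in>I. smul (c i) (x i)) = (\<Sum>i\<in>I. smul (c i) (A (x i)))"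
proof -
  have 0: "A 0 = 0" using op_smul [OF subspace_0 [OF subspace_domain], of 0] by simp
  show ?thesis
    using assms
  proof (induction I rule: infinite_finite_induct)
    case (insert i I)
    then show ?case
      by (simp add: op_add op_smul subspace_add [OF subspace_domain] subspace_scale [OF subspace_domain])
  qed (auto simp: 0 subspace_0 [OF subspace_domain])
qed

text \<open>Linearity on \<open>D\<close> splits the graph norm of \<open>u s - u t\<close> into two
  nonnegative terms, whose sum tends to 0 exactly when both do.\<close>

lemma continuous_on_into_domain_iff:
  "continuous_on_into_domain D A S u \<longleftrightarrow>
    (\<forall>t\<in>S. u t \<in> D) \<and> continuous_on S u \<and> continuous_on S (\<lambda>t. A (u t))"
proof (cases "\<forall>t\<in>S. u t \<in> D")
  case D: True
  have "((\<lambda>s. graph_norm A (u s - u t)) \<longlongrightarrow> 0) (at t within S) \<longleftrightarrow>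
      (u \<longlongrightarrow> u t) (at t within S) \<and> ((\<lambda>t. A (u t)) \<longlongrightarrow> A (u t)) (at t within S)"
    if t: "t \<in> S" for t
  proof -
    have "((\<lambda>s. graph_norm A (u s - u t)) \<longlongrightarrow> 0) (at t within S) \<longleftrightarrow>
        ((\<lambda>s. norm (u s - u t) + norm (A (u s) - A (u t))) \<longlongrightarrow> 0) (at t within S)"
      by (intro filterlim_cong) (auto simp: eventually_at_filter graph_norm_def op_diff D t)
    also have "\<dots> \<longleftrightarrow> ((\<lambda>s. norm (u s - u t)) \<longlongrightarrow> 0) (at t within S) \<and>
        ((\<lambda>s. norm (A (u s) - A (u t))) \<longlongrightarrow> 0) (at t within S)"
    proof (intro iffI conjI; (elim conjE)?)
      assume *: "((\<lambda>s. norm (u s - u t) + norm (A (u s) - A (u t))) \<longlongrightarrow> 0) (at t within S)"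
      show "((\<lambda>s. norm (u s - u t)) \<longlongrightarrow> 0) (at t within S)"
        "((\<lambda>s. norm (A (u s) - A (u t))) \<longlongrightarrow> 0) (at t within S)"
        by (rule Lim_null_comparison [OF _ *]; simp)+
    qed (use tendsto_add in fastforce)
    finally show ?thesis
      by (simp add: LIM_zero_iff tendsto_norm_zero_iff)
  qed
  then show ?thesis
    using D by (auto simp: continuous_on_into_domain_def continuous_on_def)
qed (auto simp: continuous_on_into_domain_def)

end

subsection \<open>The terminal value problem\<close>

context
  fixes D :: "'a set" and A :: "'a \<Rightarrow> 'a" and T :: real and l :: "real \<Rightarrow> real"
    and f :: "real \<Rightarrow> 'a" and u2 :: 'a
  assumes A: "selfadjoint_operator smul ip D A" and f: "Ck_on 1 {0..T} f"
begin

lemma coefficient_continuous: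
  "continuous_on S v \<Longrightarrow> continuous_on S (\<lambda>t. ip (v t) p)"
  by (rule bounded_linear.continuous_on [OF bounded_linear_ip_left])

text \<open>Symmetry moves \<open>A\<close> onto the eigenvector \<open>p\<close>, so pairing the
  equation with \<open>p\<close> gives a closed scalar equation for \<open>ip (v t) p\<close>;
  integrating it from 0 yields the Volterra form.\<close>

lemma is_solution_coefficient:
  assumes "memory_kernel T l \<mu>" and v: "is_solution D A T l f u2 v"
    and p: "p \<in> D" "A p = \<mu> *\<^sub>R p" and t: "t \<in> {0..T}"
  shows "ip (v t) p = ip (v 0) p + integral {0..t} (\<lambda>s. ip (f s) p) + \<mu> *\<^sub>R vconv (h1 l) (\<lambda>s. ip (v s) p) t"
proof -
  interpret memory_kernel T l \<mu> by fact
  let ?y = "\<lambda>s. ip (v s) p"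
  have v2: "Ck_on (Suc 1) {0..T} v"
    and vD: "\<And>s. s \<in> {0..T} \<Longrightarrow> v s \<in> D" and vc: "continuous_on {0..T} v"
    and Avc: "continuous_on {0..T} (\<lambda>s. A (v s))"
    and veq: "\<And>s. s \<in> {0..T} \<Longrightarrow> deriv_on {0..T} v s = vconv l (\<lambda>s. A (v s)) s + f s"
    using v continuous_on_into_domain_iff [OF A] by (auto simp: is_solution_def vconv_def numeral_2_eq_2)
  note yc = coefficient_continuous [OF vc]
  have sub: "{0..t} \<subseteq> {0..T}" using t by auto
  have dc: "continuous_on {0..T} (deriv_on {0..T} v)"
  proof (rule Ck_on_imp_continuous_on)
    show "Ck_on 1 {0..T} (deriv_on {0..T} v)"
      using v2 unfolding Ck_on.simps(2) [of 1] by (rule conjunct2)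
  qed
  have 1: "ip (deriv_on {0..T} v s) p = \<mu> *\<^sub>R vconv l ?y s + ip (f s) p" if s: "s \<in> {0..T}" for s
  proof -
    have "ip (vconv l (\<lambda>s. A (v s)) s) p = vconv l (\<lambda>s. ip (A (v s)) p) s"
      by (rule vconv_linear [OF bounded_linear_ip_left l_cont Avc s, symmetric])
    also have "\<dots> = vconv l (\<lambda>s. \<mu> *\<^sub>R ?y s) s"
      by (rule vconv_cong) (use s vD p selfadjoint_symmetric [OF A] in \<open>auto simp: ip_scaleR_right\<close>)
    also have "\<dots> = \<mu> *\<^sub>R vconv l ?y s"
      by (rule vconv_linear [OF bounded_linear_scaleR_right l_cont yc s])
    finally show ?thesis using veq [OF s] by (simp add: ip_add_left)
  qed
  have "ip (v t) p = ip (v 0 + integral {0..t} (deriv_on {0..T} v)) p"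
    by (subst Ck_on_Suc_imp_integral_deriv_on [OF v2 t]) simp
  also have "\<dots> = ip (v 0) p + integral {0..t} (\<lambda>s. ip (deriv_on {0..T} v s) p)"
    using integral_linear [OF integrable_continuous_real [OF continuous_on_subset [OF dc sub]] bounded_linear_ip_left [of p]]
    by (simp add: ip_add_left o_def)
  also have "integral {0..t} (\<lambda>s. ip (deriv_on {0..T} v s) p) =
      integral {0..t} (\<lambda>s. \<mu> *\<^sub>R vconv l ?y s + ip (f s) p)"
    by (rule integral_cong) (use 1 sub in auto)
  also have "\<dots> = \<mu> *\<^sub>R integral {0..t} (vconv l ?y) + integral {0..t} (\<lambda>s. ip (f s) p)"
  proof (subst integral_add)
    show "(\<lambda>s. \<mu> *\<^sub>R vconv l ?y s) integrable_on {0..t}"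
      by (intro integrable_continuous_real continuous_intros continuous_on_subset [OF continuous_on_vconv [OF l_cont yc] sub])
    show "(\<lambda>s. ip (f s) p) integrable_on {0..t}"
      by (intro integrable_continuous_real coefficient_continuous continuous_on_subset [OF _ sub] Ck_on_imp_continuous_on [OF f])
  qed simp
  finally show ?thesis using vconv_h1 [OF yc t] by simp
qed

text \<open>The forcing term cancels in the difference of two solutions, so each of its coefficients
  is \<open>E\<close> times its initial value. It vanishes at \<open>T\<close>, and
  \<open>E T \<ge> 1\<close> forces the initial value to be 0.\<close>

lemma is_solution_unique:
  fixes \<phi> :: "nat \<Rightarrow> 'a" and lam :: "nat \<Rightarrow> real"
  assumes kernel: "\<And>j. memory_kernel T l (lam j)"
    and basis: "orthonormal_basis smul ip \<phi>"
    and eigen: "\<And>j. \<phi> j \<in> D" "\<And>j. A (\<phi> j) = lam j *\<^sub>R \<phi> j"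
    and u: "is_solution D A T l f u2 u" and v: "is_solution D A T l f u2 v" and t: "t \<in> {0..T}"
  shows "v t = u t"
proof (rule eqI_coefficients [OF basis])
  fix j
  interpret memory_kernel T l "lam j" by (rule kernel)
  let ?y = "\<lambda>w t. ip (w t) (\<phi> j)"
  let ?d = "\<lambda>t. ?y v t - ?y u t"
  have c: "continuous_on {0..T} u" "continuous_on {0..T} v"
    using u v continuous_on_into_domain_iff [OF A] by (auto simp: is_solution_def)
  note yc = c [THEN coefficient_continuous, of "\<phi> j"]
  have dc: "continuous_on {0..T} ?d" by (intro continuous_intros yc)
  have "?d s = ?d 0 + lam j *\<^sub>R vconv (h1 l) ?d s" if s: "s \<in> {0..T}" for s
  proof -
    have "vconv (h1 l) (\<lambda>t. ?d t + ?y u t) s = vconv (h1 l) ?d s + vconv (h1 l) (?y u) s"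
      by (rule vconv_add_right [OF h1_cont dc yc(1) s])
    then show ?thesis
      using is_solution_coefficient [OF kernel u eigen s] is_solution_coefficient [OF kernel v eigen s]
      by (simp add: algebra_simps)
  qed
  then have E: "?d s = E s *\<^sub>R ?d 0" if "s \<in> {0..T}" for s
    using that by (rule volterra_unique [OF dc])
  have "?d T = 0" using u v by (simp add: is_solution_def)
  then have "?d 0 = 0" using E [of T] E_ge_1 [of T] T by simp
  then show "ip (v t) (\<phi> j) = ip (u t) (\<phi> j)" using E [OF t] by simp
qed

text \<open>Completeness of the basis reassembles the coefficient equations into
  \<open>u = u 0 + 1 * (l * A u + f)\<close>. Differentiating once gives the equation,
  differentiating again the regularity.\<close>

lemma is_solutionI:
  fixes \<phi> :: "nat \<Rightarrow> 'a" and lam :: "nat \<Rightarrow> real"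
  assumes kernel: "\<And>j. memory_kernel T l (lam j)"
    and basis: "orthonormal_basis smul ip \<phi>"
    and eigen: "\<And>j. \<phi> j \<in> D" "\<And>j. A (\<phi> j) = lam j *\<^sub>R \<phi> j"
    and u: "continuous_on_into_domain D A {0..T} u" "u T = u2"
    and modes: "\<And>j t. t \<in> {0..T} \<Longrightarrow> ip (u t) (\<phi> j) =
      ip (u 0) (\<phi> j) + integral {0..t} (\<lambda>s. ip (f s) (\<phi> j)) + lam j *\<^sub>R vconv (h1 l) (\<lambda>s. ip (u s) (\<phi> j)) t"
  shows "is_solution D A T l f u2 u"
proof -
  \<comment> \<open>Only facts about \<open>T\<close> and \<open>l\<close> are taken from this
    interpretation; the index 0 is an arbitrary choice.\<close>
  interpret memory_kernel T l "lam 0" by (rule kernel)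
  define w where "w t = A (u t)" for t
  have uD: "\<And>t. t \<in> {0..T} \<Longrightarrow> u t \<in> D" and uc: "continuous_on {0..T} u" and wc: "continuous_on {0..T} w"
    using u(1) continuous_on_into_domain_iff [OF A] by (auto simp: w_def [abs_def])
  have fc: "continuous_on {0..T} f" by (rule Ck_on_imp_continuous_on [OF f])
  have lwc: "continuous_on {0..T} (vconv l w)" by (rule continuous_on_vconv [OF l_cont wc])
  let ?r = "\<lambda>t. vconv l w t + f t"
  have rc: "continuous_on {0..T} ?r" by (intro continuous_intros lwc fc)
  have ueq: "u t = u 0 + integral {0..t} ?r" if t: "t \<in> {0..T}" for t
  proof (rule eqI_coefficients [OF basis])
    fix j
    let ?y = "\<lambda>s. ip (u s) (\<phi> j)"
    have yc: "continuous_on {0..T} ?y" by (rule coefficient_continuous [OF uc])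
    have sub: "{0..t} \<subseteq> {0..T}" using t by auto
    have *: "ip (vconv l w s) (\<phi> j) = lam j *\<^sub>R vconv l ?y s" if s: "s \<in> {0..T}" for s
    proof -
      have "ip (vconv l w s) (\<phi> j) = vconv l (\<lambda>s. ip (w s) (\<phi> j)) s"
        by (rule vconv_linear [OF bounded_linear_ip_left l_cont wc s, symmetric])
      also have "\<dots> = vconv l (\<lambda>s. lam j *\<^sub>R ?y s) s"
        by (rule vconv_cong) (use s uD eigen selfadjoint_symmetric [OF A] in \<open>auto simp: w_def ip_scaleR_right\<close>)
      also have "\<dots> = lam j *\<^sub>R vconv l ?y s"
        by (rule vconv_linear [OF bounded_linear_scaleR_right l_cont yc s])
      finally show ?thesis .
    qed
    have "ip (integral {0..t} ?r) (\<phi> j) = integral {0..t} (\<lambda>s. ip (?r s) (\<phi> j))"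
      using integral_linear [OF integrable_continuous_real [OF continuous_on_subset [OF rc sub]] bounded_linear_ip_left]
      by (simp add: o_def)
    also have "\<dots> = integral {0..t} (\<lambda>s. lam j *\<^sub>R vconv l ?y s + ip (f s) (\<phi> j))"
      by (rule integral_cong) (use * sub in \<open>auto simp: ip_add_left\<close>)
    also have "\<dots> = lam j *\<^sub>R integral {0..t} (vconv l ?y) + integral {0..t} (\<lambda>s. ip (f s) (\<phi> j))"
    proof (subst integral_add)
      show "(\<lambda>s. lam j *\<^sub>R vconv l ?y s) integrable_on {0..t}"
        by (intro integrable_continuous_real continuous_intros continuous_on_subset [OF continuous_on_vconv [OF l_cont yc] sub])
      show "(\<lambda>s. ip (f s) (\<phi> j)) integrable_on {0..t}"
        by (intro integrable_continuous_real coefficient_continuous continuous_on_subset [OF fc sub])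
    qed simp
    finally show "ip (u t) (\<phi> j) = ip (u 0 + integral {0..t} ?r) (\<phi> j)"
      using modes [OF t, of j] vconv_h1 [OF yc t] by (simp add: ip_add_left)
  qed
  have der: "(u has_vector_derivative ?r t) (at t within {0..T})" if t: "t \<in> {0..T}" for t
    using has_vector_derivative_add [OF has_vector_derivative_const integral_has_vector_derivative [OF rc t]]
      has_vector_derivative_cong_on [of "{0..T}" u "\<lambda>t. u 0 + integral {0..t} ?r", OF ueq t]
    by simp
  have hwc: "continuous_on {0..T} (vconv h w)" by (rule continuous_on_vconv [OF h_cont wc])
  \<comment> \<open>\<open>l = 1 * h\<close> because \<open>l 0 = 0\<close>. Hence the derivative of
    \<open>l * w\<close> is \<open>h * w\<close>, with no boundary term and no derivative falling on
    \<open>w\<close>.\<close>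
  have lw: "vconv l w t = integral {0..t} (vconv h w)" if t: "t \<in> {0..T}" for t
  proof -
    have "vconv l w t = vconv (vconv (\<lambda>_. 1) h) w t"
      by (rule vconv_cong) (use t l_eq in auto)
    also have "\<dots> = vconv (\<lambda>_. 1) (vconv h w) t"
      by (rule vconv_assoc [OF _ h_cont wc t]) simp
    finally show ?thesis by (simp add: vconv_1)
  qed
  have "Ck_on (Suc 0) {0..T} ?r"
  proof (rule Ck_on_SucI [OF T])
    show "Ck_on 0 {0..T} (\<lambda>t. vconv h w t + deriv_on {0..T} f t)"
      using f hwc by (auto intro!: continuous_intros)
    fix t assume t: "t \<in> {0..T}"
    have "(vconv l w has_vector_derivative vconv h w t) (at t within {0..T})"
      using integral_has_vector_derivative [OF hwc t] 
        has_vector_derivative_cong_on [of "{0..T}" "vconv l w" "\<lambda>t. integral {0..t} (vconv h w)", OF lw t]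
      by simp
    moreover have "(f has_vector_derivative deriv_on {0..T} f t) (at t within {0..T})"
      by (rule has_vector_derivative_deriv_on [of 0]) (use f t in auto)
    ultimately show "(?r has_vector_derivative vconv h w t + deriv_on {0..T} f t) (at t within {0..T})"
      by (rule has_vector_derivative_add)
  qed
  with T der have "Ck_on (Suc (Suc 0)) {0..T} u"
    by (rule Ck_on_SucI)
  then show ?thesis
    using u deriv_on_eqI [OF T _ der] by (simp add: is_solution_def numeral_2_eq_2 vconv_def w_def)
qed

text \<open>The candidate has the explicit Volterra solutions \<open>y j\<close> as coefficients. A
  single summable majorant \<open>B\<close>, with weight \<open>lam j ^ 3\<close>, controls both the
  series for \<open>u\<close> and the one for \<open>A u\<close>.\<close>

lemma is_solution_exists:
  fixes \<phi> :: "nat \<Rightarrow> 'a" and lam :: "nat \<Rightarrow> real"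
  assumes kernel: "\<And>j. memory_kernel T l (lam j)" and lam: "incseq lam"
    and basis: "orthonormal_basis smul ip \<phi>"
    and eigen: "\<And>j. \<phi> j \<in> D" "\<And>j. A (\<phi> j) = lam j *\<^sub>R \<phi> j"
    and series: "summable (\<lambda>j. L_coeff T l (lam j) (ip u2 (\<phi> j)) (\<lambda>t. ip (f t) (\<phi> j))
                   * lam j ^ 3 * exp (2 * lam j * M_const T l * T))"
  shows "\<exists>u. is_solution D A T l f u2 u"
proof -
  have T: "T > 0" and lam_pos: "lam j > 0" for j
    using kernel by (auto simp: memory_kernel_def)
  define b where "b j t = ip (f t) (\<phi> j)" for j t
  define c where "c j = c_coeff T l (lam j) (ip u2 (\<phi> j)) (b j)" for j
  define y where "y j t = resolvent_primitive l (lam j) t *\<^sub>R c j + vconv (resolvent_primitive l (lam j)) (b j) t" for j t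
  have bc: "continuous_on {0..T} (b j)" for j
    unfolding b_def [abs_def] by (rule coefficient_continuous [OF Ck_on_imp_continuous_on [OF f]])
  have yc: "continuous_on {0..T} (y j)" for j
  proof -
    interpret memory_kernel T l "lam j" by (rule kernel)
    show ?thesis unfolding y_def [abs_def] by (intro continuous_intros continuous_on_vconv E_cont bc)
  qed
  define Q where "Q j = L_coeff T l (lam j) (ip u2 (\<phi> j)) (b j) * exp (2 * lam j * M_const T l * T)" for j
  define K where "K = 2 * (1 + T\<^sup>2)"
  have yb: "(norm (y j t))\<^sup>2 \<le> K * Q j" if "t \<in> {0..T}" for j t
  proof -
    interpret memory_kernel T l "lam j" by (rule kernel)
    show ?thesis unfolding y_def c_def Q_def K_def by (rule mode_bound [OF bc that])
  qed
  have KQ: "0 \<le> K * Q j" for j using yb [of 0 j] T by (meson atLeastAtMost_iff less_imp_le order_refl order_trans zero_le_power2)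
  define B where "B j = K * Q j * lam j ^ 3" for j
  have B: "summable B"
    using summable_mult [OF series, of K] by (simp add: B_def [abs_def] Q_def b_def [abs_def] mult_ac)
  have lam0: "lam 0 \<le> lam j" for j using lam by (simp add: incseqD)
  \<comment> \<open>\<open>lam 0\<close> is positive and the smallest eigenvalue, so surplus powers
    of \<open>lam j\<close> are traded for powers of \<open>lam 0\<close>: three here, one in the
    bound for \<open>lam j *\<^sub>R y j t\<close>.\<close>
  have 1: "(norm (y j t))\<^sup>2 \<le> B j / lam 0 ^ 3" if t: "t \<in> {0..T}" for j t
  proof -
    have "(norm (y j t))\<^sup>2 * lam 0 ^ 3 \<le> (K * Q j) * lam j ^ 3"
      using KQ lam_pos [of 0] lam0 by (intro mult_mono yb t power_mono) (auto intro: less_imp_le)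
    then show ?thesis using lam_pos [of 0] by (simp add: B_def field_simps)
  qed
  have 2: "(norm (lam j *\<^sub>R y j t))\<^sup>2 \<le> B j / lam 0" if t: "t \<in> {0..T}" for j t
  proof -
    have "((norm (y j t))\<^sup>2 * lam 0) * (lam j)\<^sup>2 \<le> ((K * Q j) * lam j) * (lam j)\<^sup>2"
      using KQ lam_pos [of 0] lam0 by (intro mult_right_mono mult_mono yb t) (auto intro: less_imp_le)
    then show ?thesis
      using lam_pos [of 0] by (simp add: B_def field_simps power3_eq_cube power2_eq_square)
  qed
  obtain u where u: "continuous_on {0..T} u" "\<And>j t. t \<in> {0..T} \<Longrightarrow> ip (u t) (\<phi> j) = y j t"
    "\<And>t. t \<in> {0..T} \<Longrightarrow> (\<lambda>n. \<Sum>j<n. smul (y j t) (\<phi> j)) \<longlonglongrightarrow> u t"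
    by (rule uniform_limit_basis_series [OF basis yc 1 summable_divide [OF B]], assumption, rule that)
  have lyc: "continuous_on {0..T} (\<lambda>t. lam j *\<^sub>R y j t)" for j
    by (intro continuous_intros yc)
  obtain w where w: "continuous_on {0..T} w" "\<And>j t. t \<in> {0..T} \<Longrightarrow> ip (w t) (\<phi> j) = lam j *\<^sub>R y j t"
    "\<And>t. t \<in> {0..T} \<Longrightarrow> (\<lambda>n. \<Sum>j<n. smul (lam j *\<^sub>R y j t) (\<phi> j)) \<longlonglongrightarrow> w t"
    by (rule uniform_limit_basis_series [OF basis lyc 2 summable_divide [OF B]], assumption, rule that)
  \<comment> \<open>Closedness is applied to the partial sums, finite combinations of eigenvectors
    on which \<open>A\<close> acts termwise.\<close>
  have uw: "u t \<in> D \<and> A (u t) = w t" if t: "t \<in> {0..T}" for t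
  proof (rule selfadjoint_closed [OF A _ u(3) [OF t]])
    have sc: "smul c (r *\<^sub>R x) = smul (r *\<^sub>R c) x" for c r x
      by (simp add: scale_of_real [symmetric] scaleR_conv_of_real mult.commute)
    show "(\<lambda>n. A (\<Sum>j<n. smul (y j t) (\<phi> j))) \<longlonglongrightarrow> w t"
      using w(3) [OF t] op_sum [OF A, where x = \<phi>] eigen by (simp add: sc)
    show "(\<Sum>j<n. smul (y j t) (\<phi> j)) \<in> D" for n
      by (rule op_sum [OF A, THEN conjunct1]) (rule eigen)
  qed
  have "is_solution D A T l f u2 u"
  proof (rule is_solutionI [OF kernel basis eigen])
    have "continuous_on {0..T} (\<lambda>t. A (u t))"
      using w(1) by (rule continuous_on_eq) (simp add: uw)
    then show "continuous_on_into_domain D A {0..T} u"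
      using u(1) uw by (simp add: continuous_on_into_domain_iff [OF A])
    show "u T = u2"
    proof (rule eqI_coefficients [OF basis])
      fix j
      interpret memory_kernel T l "lam j" by (rule kernel)
      show "ip (u T) (\<phi> j) = ip u2 (\<phi> j)"
        using u(2) [of T j] T mode_terminal_value by (simp add: y_def c_def)
    qed
    fix j t assume t: "t \<in> {0..T}"
    interpret memory_kernel T l "lam j" by (rule kernel)
    have "vconv (h1 l) (\<lambda>s. ip (u s) (\<phi> j)) t = vconv (h1 l) (y j) t"
      by (rule vconv_cong) (use t u(2) in auto)
    \<comment> \<open>The resolvent primitive is 1 at 0 and convolutions vanish there, so the mode
      starts at \<open>c j\<close>.\<close>
    moreover have "ip (u 0) (\<phi> j) = c j"
      using u(2) [of 0 j] T by (simp add: y_def resolvent_primitive_def)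
    ultimately show "ip (u t) (\<phi> j) = ip (u 0) (\<phi> j) + integral {0..t} (\<lambda>s. ip (f s) (\<phi> j)) +
        lam j *\<^sub>R vconv (h1 l) (\<lambda>s. ip (u s) (\<phi> j)) t"
      using volterra_solution [OF bc [of j] t, where c = "c j"] u(2) [OF t]
      by (simp add: y_def [abs_def] b_def [abs_def])
  qed
  then show ?thesis by blast
qed

end

end

theorem theorem4p2:
  fixes smul :: "'k::rc_scalar \<Rightarrow> 'a::banach \<Rightarrow> 'a"
    and ip :: "'a \<Rightarrow> 'a \<Rightarrow> 'k"
    and D :: "'a set" and A :: "'a \<Rightarrow> 'a"
    and \<phi> :: "nat \<Rightarrow> 'a" and lam :: "nat \<Rightarrow> real"
    and T :: real and f :: "real \<Rightarrow> 'a" and u2 :: 'a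
    and g :: "real \<Rightarrow> 'k" and \<phi>0 :: 'a and lam0 :: real
    and l :: "real \<Rightarrow> real"
  assumes H: "hilbert_space smul ip"
    and A: "selfadjoint_operator smul ip D A"
    and basis: "orthonormal_basis smul ip \<phi>"
    and eigen: "\<And>j. \<phi> j \<in> D" "\<And>j. A (\<phi> j) = lam j *\<^sub>R \<phi> j"
    and lam: "incseq lam" "\<And>j. lam j > 0" "filterlim lam at_top sequentially"
    and T: "T > 0"
    and f: "Ck_on 1 {0..T} f"
    and g: "Ck_on 3 {0..T} g"
    and \<phi>0: "\<phi>0 \<in> D" "norm \<phi>0 = 1" "A \<phi>0 = lam0 *\<^sub>R \<phi>0" "lam0 \<noteq> 0"
    and compat1: "deriv_on {0..T} g 0 = ip (f 0) \<phi>0"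
    and compat2: "deriv_on {0..T} (deriv_on {0..T} g) 0 - ip (deriv_on {0..T} f 0) \<phi>0 = 0"
    and compat3: "g T = ip u2 \<phi>0"
    and g0: "g 0 \<noteq> 0"
    and l: "Ck_on 1 {0..T} l" "\<And>t. t \<in> {0..T} \<Longrightarrow> l t \<ge> 0" "l 0 = 0"
    and series: "summable (\<lambda>j. L_coeff T l (lam j) (ip u2 (\<phi> j)) (\<lambda>t. ip (f t) (\<phi> j))
                   * lam j ^ 3 * exp (2 * lam j * M_const T l * T))"
  shows "\<exists>u. is_solution D A T l f u2 u \<and>
           (\<forall>v. is_solution D A T l f u2 v \<longrightarrow> (\<forall>t\<in>{0..T}. v t = u t))"
proof -
  interpret hilbert_space smul ip by (rule H)
  have kernel: "memory_kernel T l (lam j)" for j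
    by unfold_locales (use T l lam in auto)
  obtain u where "is_solution D A T l f u2 u"
    using is_solution_exists [OF A f kernel lam(1) basis eigen series] by blast
  then show ?thesis
    using is_solution_unique [OF A f kernel basis eigen] by blast
qed

end
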